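(* Let $g\ge1$, $I_g=[-2,2]^g$ and $\Sigma_g=\mathsf{s}(I_g)\subset\mathbb{R}^g$, where $\mathsf{s}$ is the Viète map. Then $$\Sigma_g=\Theta_g\cap\Pi_g,$$ where $$\Pi_g=\{s\in\mathbb{R}^g : m_j(s)\ge0 \text{ for } 2\le j\le g\},\qquad \Theta_g=\{s\in\mathbb{R}^g : L_i^{+}(2;s)\ge0 \text{ and } L_i^{-}(2;s)\ge0 \text{ for } 1\le i\le g\}.$$ Moreover $\Sigma_g=\mathsf{s}(\bar A_g)$ is a semi-algebraic set homeomorphic to the $g$-dimensional simplex, and $$\Sigma_g\subset\prod_{i=1}^g\left[-2^i\binom gi,\ 2^i\binom gi\right].$$
   Context: The Viète map is $\mathsf{s}(t)=(s_1(t),\dots,s_g(t))$ for $t=(t_1,\dots,t_g)$, where $s_n(t)$ is the elementary symmetric polynomial of degree $n$ in $g$ variables. $\bar A_g=\{t\in\mathbb{R}^g : -2\le t_1\le t_2\le\dots\le t_g\le2\}$. Let $p_n(t)=t_1^n+\dots+t_g^n$ for $n\ge 0$ (so $p_0=g$). For $1\le j\le g$, $m_j\in\mathbb{Z}[s_1,\dots,s_g]$ is the polynomial obtained from the principal minor $$\det\big(p_{a+b}\big)_{0\le a,b\le j-1}$$ of the bezoutian matrix $(p_{a+b})_{0\le a,b\le g-1}$ by expressing the power sums as polynomials in the elementary symmetric polynomials; that is, $m_j(\mathsf{s}(t))=\det\big(p_{a+b}(t)\big)_{0\le a,b\le j-1}$. In particular $m_1=g$ and $m_g(\mathsf{s}(t))=\prod_{j<k}(t_k-t_j)^2$.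 In the source, $\Pi_g$ is introduced as the image $\mathsf{s}(\mathbb{R}^g)$, and a lemma there asserts that this image is the set given by the inequalities $m_j(s)\ge0$, $2\le j\le g$; the theorem refers to that lemma for the description of $\Pi_g$. With $s_0=1$, $$L_i^{+}(\lambda;s)=\sum_{k=0}^i\binom{g-i+k}{k}s_{i-k}\lambda^k,\qquad L_i^{-}(\lambda;s)=\sum_{k=0}^i\binom{g-i+k}{k}(-1)^{i-k}s_{i-k}\lambda^k.$$
   Formalization: For g≥4 the equality with Π_g={m_j≥0} is false (x^{g-4}(x^4+1) satisfies all inequalities). Here Π_g is the image s(R^g); it is shown to lie in {m_j≥0, 2≤j≤g} for all g and to equal it for g≤3. *)

theory Defs
  imports
    "HOL-Analysis.Analysis"
    "HOL-Homology.Simplices"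
    "HOL-Library.Poly_Mapping"
    "Jordan_Normal_Form.Determinant"
begin

text \<open>The space \<open>\<real>\<^sup>g\<close> is \<open>{1..g} \<rightarrow>\<^sub>E UNIV\<close>, the underlying set of the product topology
  \<open>powertop_real {1..g}\<close>, so that coordinates carry the indices \<open>1, \<dots>, g\<close>.\<close>

abbreviation RR :: "nat \<Rightarrow> (nat \<Rightarrow> real) set" where
  "RR g \<equiv> {1..g} \<rightarrow>\<^sub>E UNIV"

definition elem_sym :: "nat \<Rightarrow> nat \<Rightarrow> (nat \<Rightarrow> real) \<Rightarrow> real" where
  "elem_sym g n t = (\<Sum>B | B \<subseteq> {1..g} \<and> card B = n. \<Prod>i\<in>B. t i)"

definition viete :: "nat \<Rightarrow> (nat \<Rightarrow> real) \<Rightarrow> (nat \<Rightarrow> real)" where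
  "viete g t = (\<lambda>n\<in>{1..g}. elem_sym g n t)"

definition cube :: "nat \<Rightarrow> (nat \<Rightarrow> real) set" where
  "cube g = {1..g} \<rightarrow>\<^sub>E {-2..2}"

definition alcove_closure :: "nat \<Rightarrow> (nat \<Rightarrow> real) set" where
  "alcove_closure g = {t \<in> RR g. (\<forall>i\<in>{1..g}. -2 \<le> t i \<and> t i \<le> 2)
     \<and> (\<forall>i\<in>{1..g}. \<forall>j\<in>{1..g}. i \<le> j \<longrightarrow> t i \<le> t j)}"

definition Sigma_region :: "nat \<Rightarrow> (nat \<Rightarrow> real) set" where
  "Sigma_region g = viete g ` cube g"


subsection \<open>Polynomials in the variables \<open>s\<^sub>1, s\<^sub>2, \<dots>\<close>\<close>

type_synonym 'a mpoly = "(nat \<Rightarrow>\<^sub>0 nat) \<Rightarrow>\<^sub>0 'a"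

text \<open>Evaluation at \<open>x\<close>, the coefficients being sent to the reals by \<open>h\<close>.\<close>

definition meval :: "('a::zero \<Rightarrow> real) \<Rightarrow> (nat \<Rightarrow> real) \<Rightarrow> 'a mpoly \<Rightarrow> real" where
  "meval h x p = (\<Sum>m\<in>Poly_Mapping.keys p. h (Poly_Mapping.lookup p m) *
     (\<Prod>i\<in>Poly_Mapping.keys m. x i ^ Poly_Mapping.lookup m i))"

definition in_vars :: "nat \<Rightarrow> 'a::zero mpoly \<Rightarrow> bool" where
  "in_vars g p \<longleftrightarrow> (\<forall>m\<in>Poly_Mapping.keys p. Poly_Mapping.keys m \<subseteq> {1..g})"

definition svar :: "nat \<Rightarrow> nat \<Rightarrow> int mpoly" where
  "svar g n = (if n \<in> {1..g} then Poly_Mapping.single (Poly_Mapping.single n 1) 1 else 0)"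

text \<open>The power sums of \<open>g\<close> variables, expressed through the elementary symmetric polynomials by
  Newton's identities \<open>p\<^sub>n = (-1)\<^sup>n\<^sup>-\<^sup>1 n s\<^sub>n + \<Sum>\<^sub>1\<^sub>\<le>\<^sub>i\<^sub><\<^sub>n (-1)\<^sup>i\<^sup>-\<^sup>1 s\<^sub>i p\<^sub>n\<^sub>-\<^sub>i\<close>,
  where \<open>s\<^sub>i = 0\<close> for \<open>i > g\<close>. See \<open>meval_power_sum_poly\<close> below.\<close>

fun power_sum_poly :: "nat \<Rightarrow> nat \<Rightarrow> int mpoly" where
  "power_sum_poly g 0 = of_nat g"
| "power_sum_poly g (Suc n) = (-1) ^ n * of_nat (Suc n) * svar g (Suc n)
     + (\<Sum>i\<in>{1..n}. (-1) ^ (i - 1) * svar g i * power_sum_poly g (Suc n - i))"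

definition power_sum :: "nat \<Rightarrow> (nat \<Rightarrow> real) \<Rightarrow> nat \<Rightarrow> real" where
  "power_sum g t n = (\<Sum>i=1..g. t i ^ n)"

text \<open>\<open>minor_poly g j\<close> is \<open>m\<^sub>j\<close>; it is characterised by \<open>minor_poly_viete\<close> below.\<close>

definition minor_poly :: "nat \<Rightarrow> nat \<Rightarrow> int mpoly" where
  "minor_poly g j = Determinant.det (Matrix.mat j j (\<lambda>(a, b). power_sum_poly g (a + b)))"


lemma meval_superset:
  assumes "finite K" "Poly_Mapping.keys p \<subseteq> K" "h 0 = 0"
  shows "meval h x p = (\<Sum>m\<in>K. h (Poly_Mapping.lookup p m) *
     (\<Prod>i\<in>Poly_Mapping.keys m. x i ^ Poly_Mapping.lookup m i))"
  unfolding meval_def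
  by (rule sum.mono_neutral_left) (use assms in \<open>auto simp: in_keys_iff\<close>)

lemma monom_add:
  fixes x :: "nat \<Rightarrow> real" and m n :: "nat \<Rightarrow>\<^sub>0 nat"
  shows "(\<Prod>i\<in>Poly_Mapping.keys (m + n). x i ^ Poly_Mapping.lookup (m + n) i) =
    (\<Prod>i\<in>Poly_Mapping.keys m. x i ^ Poly_Mapping.lookup m i) *
    (\<Prod>i\<in>Poly_Mapping.keys n. x i ^ Poly_Mapping.lookup n i)"
proof -
  define K where "K = Poly_Mapping.keys m \<union> Poly_Mapping.keys n"
  have *: "(\<Prod>i\<in>Poly_Mapping.keys q. x i ^ Poly_Mapping.lookup q i) =
      (\<Prod>i\<in>K. x i ^ Poly_Mapping.lookup q i)" if "Poly_Mapping.keys q \<subseteq> K" for q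
    by (rule prod.mono_neutral_left) (use that in \<open>auto simp: in_keys_iff K_def\<close>)
  have "Poly_Mapping.keys (m + n) \<subseteq> K" "Poly_Mapping.keys m \<subseteq> K" "Poly_Mapping.keys n \<subseteq> K"
    using Poly_Mapping.keys_add[of m n] by (auto simp: K_def)
  then show ?thesis
    unfolding *[OF \<open>Poly_Mapping.keys (m + n) \<subseteq> K\<close>] *[OF \<open>Poly_Mapping.keys m \<subseteq> K\<close>]
      *[OF \<open>Poly_Mapping.keys n \<subseteq> K\<close>]
    by (simp add: lookup_add power_add prod.distrib)
qed

lemma meval_of_int_hom:
  "comm_ring_hom (meval (of_int :: int \<Rightarrow> real) x)"
proof -
  let ?e = "meval (of_int :: int \<Rightarrow> real) x"
  have add: "?e (p + q) = ?e p + ?e q" for p q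
  proof -
    define K where "K = Poly_Mapping.keys p \<union> Poly_Mapping.keys q"
    have "Poly_Mapping.keys (p + q) \<subseteq> K"
      using Poly_Mapping.keys_add[of p q] by (auto simp: K_def)
    then show ?thesis
      by (subst (1 2 3) meval_superset[of K])
        (auto simp: K_def lookup_add sum.distrib algebra_simps)
  qed
  have zero: "?e 0 = 0" and one: "?e 1 = 1"
    by (simp_all add: meval_def lookup_one)
  have e_sum: "?e (sum f A) = (\<Sum>a\<in>A. ?e (f a))" if "finite A"
    for f :: "(nat \<Rightarrow>\<^sub>0 nat) \<Rightarrow> int mpoly" and A
    using that by (induction A) (auto simp: zero add)
  have single: "?e (Poly_Mapping.single m c) =
      of_int c * (\<Prod>i\<in>Poly_Mapping.keys m. x i ^ Poly_Mapping.lookup m i)" for m c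
    by (simp add: meval_def)
  have expand: "p = (\<Sum>m\<in>Poly_Mapping.keys p. Poly_Mapping.single m (Poly_Mapping.lookup p m))"
    for p :: "int mpoly"
    by (rule poly_mapping_eqI)
      (simp add: lookup_sum lookup_single when_def in_keys_iff sum.delta)
  have mult: "?e (p * q) = ?e p * ?e q" for p q
  proof -
    let ?s = "\<lambda>p m. Poly_Mapping.single m (Poly_Mapping.lookup p m) :: int mpoly"
    have "?e (p * q) = ?e (sum (?s p) (Poly_Mapping.keys p) * sum (?s q) (Poly_Mapping.keys q))"
      by (rule arg_cong[of _ _ ?e], rule arg_cong2[of _ _ _ _ "(*)"]) (rule expand)+
    also have "\<dots> = (\<Sum>m\<in>Poly_Mapping.keys p. \<Sum>n\<in>Poly_Mapping.keys q. ?e (?s p m * ?s q n))"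
      by (simp add: sum_product e_sum)
    also have "\<dots> = (\<Sum>m\<in>Poly_Mapping.keys p. \<Sum>n\<in>Poly_Mapping.keys q. ?e (?s p m) * ?e (?s q n))"
      unfolding mult_single single monom_add by (simp add: mult_ac)
    also have "\<dots> = ?e p * ?e q"
      unfolding sum_product[symmetric] single by (simp add: meval_def)
    finally show ?thesis .
  qed
  show ?thesis
    by unfold_locales (simp_all add: add zero one mult)
qed

interpretation meval_int: comm_ring_hom "meval (of_int :: int \<Rightarrow> real) x" for x
  by (rule meval_of_int_hom)

lemma elem_sym_0 [simp]: "elem_sym g 0 t = 1"
proof -
  have "{B. B \<subseteq> {1..g} \<and> card B = 0} = {{}}"
    by (auto dest: finite_subset[OF _ finite_atLeastAtMost])
  then show ?thesis
    by (simp add: elem_sym_def)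
qed

lemma elem_sym_eq_0: "g < n \<Longrightarrow> elem_sym g n t = 0"
proof -
  assume "g < n"
  then have "\<not> (B \<subseteq> {1..g} \<and> card B = n)" for B
    using card_mono[OF finite_atLeastAtMost, of B 1 g] by auto
  then have "{B. B \<subseteq> {1..g} \<and> card B = n} = {}"
    by blast
  then show ?thesis
    unfolding elem_sym_def by (simp only: sum.empty)
qed

lemma elem_sym_Suc_Suc:
  "elem_sym (Suc g) (Suc n) t = elem_sym g (Suc n) t + t (Suc g) * elem_sym g n t"
proof -
  let ?S = "\<lambda>k n. {B. B \<subseteq> {1..k::nat} \<and> card B = n}"
  have fin: "finite (?S k n)" for k n
    by (rule finite_subset[of _ "Pow {1..k}"]) auto
  have eq: "?S (Suc g) (Suc n) = ?S g (Suc n) \<union> insert (Suc g) ` ?S g n" (is "?L = ?R")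
  proof
    show "?L \<subseteq> ?R"
    proof
      fix B assume B: "B \<in> ?L"
      show "B \<in> ?R"
      proof (cases "Suc g \<in> B")
        case True
        have "B = insert (Suc g) (B - {Suc g})" using True by auto
        moreover have "B - {Suc g} \<in> ?S g n"
          using B True by (auto simp: card_Diff_singleton le_Suc_eq)
        ultimately show ?thesis by blast
      next
        case False
        have "x \<le> g" if "x \<in> B" for x
        proof -
          have "x \<le> Suc g" "x \<noteq> Suc g" using B that False by auto
          then show ?thesis by simp
        qed
        then show ?thesis using B by auto
      qed
    qed
    show "?R \<subseteq> ?L"
    proof
      fix B assume "B \<in> ?R"
      then consider "B \<in> ?S g (Suc n)" | C where "C \<in> ?S g n" "B = insert (Suc g) C" by blast
      then show "B \<in> ?L"
      proof cases
        case 1 then show ?thesis by fastforce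
      next
        case 2
        then have "finite C" "Suc g \<notin> C" by (auto intro: finite_subset)
        with 2 show ?thesis by fastforce
      qed
    qed
  qed
  have inj: "inj_on (insert (Suc g)) (?S g n)"
    by (rule inj_onI, drule arg_cong[of _ _ "\<lambda>B. B - {Suc g}"]) fastforce
  have "(\<Prod>i\<in>insert (Suc g) B. t i) = t (Suc g) * (\<Prod>i\<in>B. t i)" if "B \<in> ?S g n" for B
  proof -
    have "finite B" "Suc g \<notin> B" using that by (auto intro: finite_subset)
    then show ?thesis by simp
  qed
  then have "(\<Sum>B\<in>insert (Suc g) ` ?S g n. \<Prod>i\<in>B. t i) = t (Suc g) * elem_sym g n t"
    unfolding elem_sym_def sum_distrib_left sum.reindex[OF inj] by (intro sum.cong) auto
  moreover have disj: "?S g (Suc n) \<inter> insert (Suc g) ` ?S g n = {}"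
    by auto
  have "elem_sym (Suc g) (Suc n) t = elem_sym g (Suc n) t
      + (\<Sum>B\<in>insert (Suc g) ` ?S g n. \<Prod>i\<in>B. t i)"
    unfolding elem_sym_def eq
    by (rule sum.union_disjoint[OF fin finite_imageI[OF fin] disj])
  ultimately show ?thesis
    by simp
qed

lemma newton_identity:
  "(\<Sum>i<n. (-1) ^ i * elem_sym g i t * power_sum g t (n - i)) = - ((-1) ^ n * real n * elem_sym g n t)"
proof (induction g arbitrary: n)
  case 0
  show ?case
    by (cases n) (auto simp: power_sum_def elem_sym_eq_0)
next
  case (Suc g)
  show ?case
  proof (cases n)
    case 0
    then show ?thesis by simp
  next
    case (Suc k)
    define y where "y = t (Suc g)"
    define e where "e = (\<lambda>i. elem_sym g i t)"
    define e' where "e' = (\<lambda>i. elem_sym (Suc g) i t)"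
    define N where "N = (\<lambda>n. \<Sum>i<n. (-1) ^ i * e i * power_sum g t (n - i))"
    have IH: "N n = - ((-1) ^ n * real n * e n)" for n
      unfolding N_def e_def by (rule Suc.IH)
    have e'0: "e' 0 = 1" and e0: "e 0 = 1" by (simp_all add: e_def e'_def)
    have e'S: "e' (Suc i) = e (Suc i) + y * e i" for i
      by (simp add: e_def e'_def y_def elem_sym_Suc_Suc)
    have ps: "power_sum (Suc g) t m = power_sum g t m + y ^ m" for m
      by (simp add: power_sum_def y_def)
    have shift: "(\<Sum>i<Suc k. (-1) ^ i * e' i * f i) =
        (\<Sum>i<Suc k. (-1) ^ i * e i * f i) - y * (\<Sum>i<k. (-1) ^ i * e i * f (Suc i))"
      for f :: "nat \<Rightarrow> real"
      by (simp only: sum.lessThan_Suc_shift)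
        (simp add: e'0 e0 e'S algebra_simps sum.distrib sum_distrib_left sum_subtractf sum_negf)
    have A: "(\<Sum>i<Suc k. (-1) ^ i * e' i * power_sum g t (Suc k - i)) = N (Suc k) - y * N k"
      unfolding shift N_def by simp
    have "y * (\<Sum>i<k. (-1) ^ i * e i * y ^ (Suc k - Suc i)) = (\<Sum>i<k. (-1) ^ i * e i * y ^ (Suc k - i))"
      by (auto simp: sum_distrib_left Suc_diff_le intro!: sum.cong)
    then have B: "(\<Sum>i<Suc k. (-1) ^ i * e' i * y ^ (Suc k - i)) = (-1) ^ k * e k * y"
      unfolding shift by simp
    have "(\<Sum>i<n. (-1) ^ i * e' i * power_sum (Suc g) t (n - i)) =
        N (Suc k) - y * N k + (-1) ^ k * e k * y"
      unfolding Suc ps distrib_left sum.distrib A B ..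
    also have "\<dots> = - ((-1) ^ n * real n * e' n)"
      unfolding IH Suc e'S by (simp add: algebra_simps)
    finally show ?thesis
      by (simp add: e'_def)
  qed
qed

lemma meval_svar: "meval of_int (viete g t) (svar g n) = (if n = 0 then 0 else elem_sym g n t)"
  by (auto simp: svar_def meval_def viete_def elem_sym_eq_0)

lemma meval_power_sum_poly:
  "meval of_int (viete g t) (power_sum_poly g n) = power_sum g t n"
proof (induction n rule: less_induct)
  case (less n)
  show ?case
  proof (cases n)
    case 0
    then show ?thesis
      by (simp add: power_sum_def hom_distribs)
  next
    case (Suc k)
    have "{..<Suc k} = insert 0 {1..k}" by auto
    then have "(\<Sum>i<Suc k. (-1) ^ i * elem_sym g i t * power_sum g t (Suc k - i)) =
      power_sum g t (Suc k) + (\<Sum>i\<in>{1..k}. (-1) ^ i * elem_sym g i t * power_sum g t (Suc k - i))"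
      by simp
    then have "power_sum g t (Suc k) = (-1) ^ k * real (Suc k) * elem_sym g (Suc k) t
        - (\<Sum>i\<in>{1..k}. (-1) ^ i * elem_sym g i t * power_sum g t (Suc k - i))"
      using newton_identity[of g t "Suc k"] by simp
    also have "\<dots> = (-1) ^ k * real (Suc k) * elem_sym g (Suc k) t
        + (\<Sum>i\<in>{1..k}. (-1) ^ (i - 1) * elem_sym g i t * power_sum g t (Suc k - i))"
      unfolding diff_conv_add_uminus sum_negf[symmetric]
      by (intro arg_cong2[of _ _ _ _ "(+)"] refl sum.cong) (auto simp: power_eq_if)
    also have "\<dots> = meval of_int (viete g t) (power_sum_poly g (Suc k))"
    proof -
      have "meval of_int (viete g t) (power_sum_poly g (Suc k - i)) = power_sum g t (Suc k - i)"
        if "i \<in> {1..k}" for i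
        using that by (intro less) (simp add: Suc)
      then show ?thesis
        by (auto simp: hom_distribs meval_svar simp del: of_nat_Suc intro!: sum.cong)
    qed
    finally show ?thesis
      using Suc by simp
  qed
qed

lemma meval_minor_poly:
  "meval of_int s (minor_poly g j) =
     Determinant.det (Matrix.mat j j (\<lambda>(a, b). meval of_int s (power_sum_poly g (a + b))))"
  unfolding minor_poly_def meval_int.hom_det[symmetric]
  by (intro arg_cong[of _ _ Determinant.det]) (auto intro!: eq_matI)

theorem minor_poly_viete:
  "meval of_int (viete g t) (minor_poly g j) =
     Determinant.det (Matrix.mat j j (\<lambda>(a, b). power_sum g t (a + b)))"
  by (simp add: meval_minor_poly meval_power_sum_poly)


subsection \<open>The sets \<open>\<Pi>\<^sub>g\<close> and \<open>\<Theta>\<^sub>g\<close>\<close>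

definition Pi_region :: "nat \<Rightarrow> (nat \<Rightarrow> real) set" where
  "Pi_region g = viete g ` RR g"

text \<open>The inequalities \<open>m\<^sub>j \<ge> 0\<close> hold on \<open>\<Pi>\<^sub>g = \<s>(\<real>\<^sup>g)\<close>, but for \<open>g \<ge> 4\<close> they do not imply that the
  polynomial with coefficients \<open>s\<close> has only real roots; see \<open>Pi_minors_too_large\<close> below.
  Hence the two sets are kept apart.\<close>

definition Pi_minors :: "nat \<Rightarrow> (nat \<Rightarrow> real) set" where
  "Pi_minors g = {s \<in> RR g. \<forall>j\<in>{2..g}. 0 \<le> meval of_int s (minor_poly g j)}"

definition s0 :: "(nat \<Rightarrow> real) \<Rightarrow> nat \<Rightarrow> real" where
  "s0 s n = (if n = 0 then 1 else s n)"

definition L_plus :: "nat \<Rightarrow> nat \<Rightarrow> real \<Rightarrow> (nat \<Rightarrow> real) \<Rightarrow> real" where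
  "L_plus g i l s = (\<Sum>k=0..i. real ((g - i + k) choose k) * s0 s (i - k) * l ^ k)"

definition L_minus :: "nat \<Rightarrow> nat \<Rightarrow> real \<Rightarrow> (nat \<Rightarrow> real) \<Rightarrow> real" where
  "L_minus g i l s =
     (\<Sum>k=0..i. real ((g - i + k) choose k) * (-1) ^ (i - k) * s0 s (i - k) * l ^ k)"

definition Theta_region :: "nat \<Rightarrow> (nat \<Rightarrow> real) set" where
  "Theta_region g = {s \<in> RR g. \<forall>i\<in>{1..g}. 0 \<le> L_plus g i 2 s \<and> 0 \<le> L_minus g i 2 s}"

inductive_set semialgebraic_sets :: "nat \<Rightarrow> (nat \<Rightarrow> real) set set" for g :: nat where
  pos: "in_vars g (p :: real mpoly) \<Longrightarrow> {x \<in> RR g. 0 < meval (\<lambda>c. c) x p} \<in> semialgebraic_sets g"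
| compl: "A \<in> semialgebraic_sets g \<Longrightarrow> RR g - A \<in> semialgebraic_sets g"
| union: "A \<in> semialgebraic_sets g \<Longrightarrow> B \<in> semialgebraic_sets g \<Longrightarrow> A \<union> B \<in> semialgebraic_sets g"
| inter: "A \<in> semialgebraic_sets g \<Longrightarrow> B \<in> semialgebraic_sets g \<Longrightarrow> A \<inter> B \<in> semialgebraic_sets g"


lemma meval_power_sum_poly_Suc:
  "meval of_int s (power_sum_poly g (Suc n)) =
     (-1) ^ n * real (Suc n) * meval of_int s (svar g (Suc n))
     + (\<Sum>i\<in>{1..n}. (-1) ^ (i - 1) * meval of_int s (svar g i)
          * meval of_int s (power_sum_poly g (Suc n - i)))"
  by (simp add: hom_distribs del: of_nat_Suc)

declare power_sum_poly.simps [simp del]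

text \<open>The point \<open>(0, 0, 0, 1)\<close>, i.e.\ the polynomial \<open>x\<^sup>4 + 1\<close>, satisfies all the inequalities
  \<open>m\<^sub>j \<ge> 0\<close> (one finds \<open>m\<^sub>2 = m\<^sub>3 = 0\<close> and \<open>m\<^sub>4 = 256\<close>) and lies in \<open>\<Theta>\<^sub>4\<close>.\<close>

lemma Pi_minors_too_large:
  defines "s \<equiv> (\<lambda>n\<in>{1..4}. if n = 4 then 1 else 0 :: real)"
  shows "s \<in> Theta_region 4 \<inter> Pi_minors 4" and "s \<notin> Pi_region 4" and "s \<notin> Sigma_region 4"
proof -
  have sv: "meval of_int s (svar 4 n) = (if n = 4 then 1 else 0)" for n
    by (auto simp: svar_def meval_def s_def)
  let ?p = "\<lambda>n. meval of_int s (power_sum_poly 4 n)"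
  have sum4: "(\<Sum>i\<in>{1..n}. (-1) ^ (i - 1) * meval of_int s (svar 4 i) * ?p (Suc n - i)) =
      (if 4 \<le> n then - ?p (n - 3) else 0)" for n
    unfolding sv by (auto simp: sum.delta if_distrib if_distribR cong: if_cong)
  have step: "?p (Suc n) = (-1) ^ n * real (Suc n) * (if Suc n = 4 then 1 else 0)
      + (if 4 \<le> n then - ?p (n - 3) else 0)" for n
    unfolding meval_power_sum_poly_Suc sum4 by (simp only: sv)
  have p0: "?p 0 = 4" by (simp add: power_sum_poly.simps hom_distribs)
  have p1: "?p (Suc 0) = 0" using step[of 0] by simp
  have p2: "?p 2 = 0" using step[of 1] by (simp add: numeral_2_eq_2)
  have p3: "?p 3 = 0" using step[of 2] by (simp add: numeral_3_eq_3)
  have p4: "?p 4 = -4" using step[of 3] by simp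
  have p5: "?p 5 = 0" using step[of 4] by (simp add: p1)
  have p6: "?p 6 = 0" using step[of 5] by (simp add: p2)
  have p_less_4: "?p n = 0" if "1 \<le> n" "n \<le> 3" for n
  proof -
    consider "n = Suc 0" | "n = 2" | "n = 3" using \<open>1 \<le> n\<close> \<open>n \<le> 3\<close> by linarith
    then show ?thesis using p1 p2 p3 by cases auto
  qed
  have minor: "meval of_int s (minor_poly 4 j) =
      (\<Sum>\<pi> | \<pi> permutes {0..<j}. signof \<pi> * (\<Prod>i=0..<j. ?p (i + \<pi> i)))" for j
  proof -
    have "(\<Prod>i=0..<j. Matrix.mat j j (\<lambda>(a, b). ?p (a + b)) $$ (i, \<pi> i)) =
        (\<Prod>i=0..<j. ?p (i + \<pi> i))" if "\<pi> permutes {0..<j}" for \<pi>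
    proof (rule prod.cong)
      fix i assume "i \<in> {0..<j}"
      moreover from this have "\<pi> i \<in> {0..<j}" using permutes_in_image[OF that] by blast
      ultimately show "Matrix.mat j j (\<lambda>(a, b). ?p (a + b)) $$ (i, \<pi> i) = ?p (i + \<pi> i)" by simp
    qed simp
    then show ?thesis
      unfolding meval_minor_poly by (subst det_def'[of _ j]) auto
  qed
  have m23: "meval of_int s (minor_poly 4 j) = 0" if j: "j \<in> {2, 3}" for j
    unfolding minor
  proof (rule sum.neutral, rule ballI)
    fix \<pi> assume "\<pi> \<in> {\<pi>. \<pi> permutes {0..<j}}"
    then have "\<pi> 1 \<in> {0..<j}" using j permutes_in_image[of \<pi> "{0..<j}" 1] by auto
    then have "?p (1 + \<pi> 1) = 0" using j by (intro p_less_4) auto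
    then have "(\<Prod>i=0..<j. ?p (i + \<pi> i)) = 0" using j by (intro prod_zero bexI[of _ 1]) auto
    then show "signof \<pi> * (\<Prod>i=0..<j. ?p (i + \<pi> i)) = 0" by simp
  qed
  have m4: "meval of_int s (minor_poly 4 4) = 256"
  proof -
    let ?f = "\<lambda>\<pi>. signof \<pi> * (\<Prod>i=0..<4. ?p (i + \<pi> i))"
    let ?\<tau> = "Transposition.transpose 1 (3::nat)"
    have \<tau>: "?\<tau> permutes {0..<4}" by (rule permutes_swap_id) auto
    have "sum ?f {\<pi>. \<pi> permutes {0..<4}} = sum ?f {?\<tau>}"
    proof (rule sum.mono_neutral_right)
      show "\<forall>\<pi>\<in>{\<pi>. \<pi> permutes {0..<4}} - {?\<tau>}. ?f \<pi> = 0"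
      proof
        fix \<pi> assume "\<pi> \<in> {\<pi>. \<pi> permutes {0..<4}} - {?\<tau>}"
        then have \<pi>: "\<pi> permutes {0..<4}" and ne: "\<pi> \<noteq> ?\<tau>" by auto
        obtain i where i: "\<pi> i \<noteq> ?\<tau> i" using ne by auto
        then have i4: "i < 4"
          using permutes_not_in[OF \<pi>] permutes_not_in[OF \<tau>] by (metis atLeastLessThan_iff le0)
        have \<pi>4: "\<pi> k < 4" if "k < 4" for k using permutes_in_image[OF \<pi>] that by simp
        have "\<exists>k<4. ?p (k + \<pi> k) = 0"
        proof (rule ccontr)
          assume "\<not> (\<exists>k<4. ?p (k + \<pi> k) = 0)"
          then have nz: "?p (k + \<pi> k) \<noteq> 0" if "k < 4" for k using that by blast
          have k04: "k + \<pi> k = 0 \<or> k + \<pi> k = 4" if "k < 4" for k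
          proof (rule ccontr)
            assume "\<not> (k + \<pi> k = 0 \<or> k + \<pi> k = 4)"
            with \<pi>4[OF that] that consider "1 \<le> k + \<pi> k" "k + \<pi> k \<le> 3" | "k + \<pi> k = 5" | "k + \<pi> k = 6"
              by linarith
            then show False using nz[OF that] p_less_4 p5 p6 by cases auto
          qed
          consider "i = 0" | "i = 1" | "i = 2" | "i = 3" using i4 by linarith
          then show False
            using i k04[OF i4] \<pi>4[OF i4] by cases (auto simp: Transposition.transpose_def)
        qed
        then have "(\<Prod>i=0..<4. ?p (i + \<pi> i)) = 0" by (intro prod_zero) auto
        then show "?f \<pi> = 0" by simp
      qed
    qed (use \<tau> in \<open>auto intro: finite_permutations\<close>)
    also have "\<dots> = 256"
    proof -
      have "(\<Prod>i=0..<4. ?p (i + ?\<tau> i)) = ?p 0 * ?p 4 * ?p 4 * ?p 4"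
        by (simp add: numeral_eq_Suc Transposition.transpose_def)
      then show ?thesis by (simp add: sign_swap_id p0 p4)
    qed
    finally show ?thesis unfolding minor .
  qed
  have sRR: "s \<in> RR 4"
    by (simp add: s_def)
  have s0_s: "s0 s n = (if n = 0 \<or> n = 4 then 1 else 0)" if "n \<le> 4" for n
    using that by (simp add: s0_def s_def)
  have "s \<in> Pi_minors 4"
  proof -
    have "{2..4} = {2, 3, 4::nat}" by auto
    then show ?thesis
      using sRR by (auto simp: Pi_minors_def m23 m4)
  qed
  moreover have "s \<in> Theta_region 4"
  proof -
    have "{1..4} = {1, 2, 3, 4::nat}" by auto
    then show ?thesis
      using sRR by (simp add: Theta_region_def L_plus_def L_minus_def s0_s numeral_eq_Suc)
  qed
  ultimately show "s \<in> Theta_region 4 \<inter> Pi_minors 4" by blast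
  show "s \<notin> Pi_region 4"
  proof
    assume "s \<in> Pi_region 4"
    then obtain t where t: "s = viete 4 t" by (auto simp: Pi_region_def)
    have "power_sum 4 t 2 = 0"
      using p2 unfolding t meval_power_sum_poly .
    then have z: "t i = 0" if "i \<in> {1..4}" for i
      using that by (simp add: power_sum_def sum_nonneg_eq_0_iff)
    have "elem_sym 4 4 t = 0"
      unfolding elem_sym_def
    proof (rule sum.neutral, safe)
      fix B :: "nat set" assume B: "B \<subseteq> {1..4}" "card B = 4"
      then have "finite B" "B \<noteq> {}" by (auto intro: finite_subset)
      then obtain b where "b \<in> B" by blast
      with B z[of b] have "t b = 0" by blast
      with \<open>finite B\<close> \<open>b \<in> B\<close> show "prod t B = 0" by (intro prod_zero) auto
    qed
    moreover have "s 4 = 1" by (simp add: s_def)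
    ultimately show False using t by (simp add: viete_def)
  qed
  then show "s \<notin> Sigma_region 4"
    by (auto simp: Pi_region_def Sigma_region_def cube_def PiE_iff)
qed

end

theory Submission
  imports Defs "Jordan_Normal_Form.Char_Poly"
begin

text \<open>For \<open>s = \<s>(t)\<close> the numbers \<open>L\<^sub>i\<^sup>\<plusminus>(2; s)\<close> are the elementary symmetric polynomials of
  the numbers \<open>2 \<plusminus> t\<^sub>j\<close>, and a monic polynomial with nonnegative coefficients has no positive root;
  hence \<open>\<Theta>\<^sub>g\<close> cuts \<open>\<Sigma>\<^sub>g\<close> out of \<open>\<Pi>\<^sub>g\<close>. Since the minors \<open>m\<^sub>j\<close> do not describe \<open>\<Pi>\<^sub>g\<close>
  in general, semialgebraicity rests on Hermite's criterion: a real polynomial has only real roots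
  iff the Hankel matrix \<open>H\<close> of its power sums is positive semidefinite, that is, iff the characteristic
  polynomial of \<open>-H\<close> has nonnegative coefficients, and these are polynomials in \<open>s\<close>. A point of the
  alcove is determined by its increments, which are barycentric coordinates up to scaling, and by the
  monic polynomial with its entries as roots; so the simplex is mapped continuously and bijectively
  onto \<open>\<Sigma>\<^sub>g\<close>, and compactness does the rest.\<close>

subsection \<open>Elementary symmetric polynomials and the inequalities of \<open>\<Theta>\<^sub>g\<close>\<close>

lemma elem_sym_0_Suc [simp]: "elem_sym 0 (Suc n) t = 0"
  by (simp add: elem_sym_eq_0)

lemma elem_sym_cong:
  assumes "\<And>i. i \<in> {1..g} \<Longrightarrow> t i = u i"
  shows "elem_sym g n t = elem_sym g n u"
  unfolding elem_sym_def by (intro sum.cong prod.cong) (use assms in auto)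

text \<open>For i <= g both sides are the coefficient of x^(g-i) in the product of all x + t_j + l.
  The induction on g combines the recursion \<open>elem_sym_Suc_Suc\<close> with Pascal's
  rule.\<close>

lemma elem_sym_shift:
  "elem_sym g i (\<lambda>j. t j + l) =
     (\<Sum>m\<le>i. real ((g - m) choose (i - m)) * elem_sym g m t * l ^ (i - m))"
proof (induction g arbitrary: i)
  case 0
  show ?case
    by (cases i) (simp_all add: sum.atMost_shift)
next
  case (Suc g)
  show ?case
  proof (cases i)
    case 0
    then show ?thesis by simp
  next
    case (Suc i')
    define e where "e = (\<lambda>m. elem_sym g m t)"
    define y where "y = t (Suc g)"
    define F where "F = (\<lambda>i. \<Sum>m\<le>i. real ((g - m) choose (i - m)) * e m * l ^ (i - m))"
    have IH: "elem_sym g i (\<lambda>j. t j + l) = F i" for i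
      using Suc.IH[of i] by (simp add: F_def e_def)
    \<comment> \<open>For m > g truncated subtraction spoils Pascal's rule, but then
      \<open>e m\<close> is 0.\<close>
    have pascal: "real ((Suc g - m) choose (Suc i' - m)) * e m * l ^ (Suc i' - m) =
        real ((g - m) choose (Suc i' - m)) * e m * l ^ (Suc i' - m)
        + l * (real ((g - m) choose (i' - m)) * e m * l ^ (i' - m))" if "m \<le> i'" for m
      using that by (cases "m \<le> g")
        (simp_all add: Suc_diff_le algebra_simps e_def elem_sym_eq_0)
    have top: "(\<Sum>m\<le>Suc i'. real ((Suc g - m) choose (Suc i' - m)) * e m * l ^ (Suc i' - m))
        = F (Suc i') + l * F i'"
      by (simp add: pascal F_def sum.distrib sum_distrib_left)
    have "(\<Sum>m\<le>Suc i'. real ((Suc g - m) choose (Suc i' - m)) * elem_sym (Suc g) m t * l ^ (Suc i' - m))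
      = real (Suc g choose Suc i') * l ^ Suc i' + (\<Sum>m\<le>i'. real ((g - m) choose (i' - m)) * (e (Suc m) + y * e m) * l ^ (i' - m))"
      by (subst sum.atMost_Suc_shift) (simp add: elem_sym_Suc_Suc e_def y_def)
    also have "\<dots> = (\<Sum>m\<le>Suc i'. real ((Suc g - m) choose (Suc i' - m)) * e m * l ^ (Suc i' - m)) + y * F i'"
      by (subst sum.atMost_Suc_shift) (simp add: e_def F_def algebra_simps sum.distrib sum_distrib_left)
    also have "\<dots> = F (Suc i') + (y + l) * F i'"
      unfolding top by (simp add: algebra_simps)
    also have "\<dots> = elem_sym (Suc g) i (\<lambda>j. t j + l)"
      by (simp add: Suc elem_sym_Suc_Suc IH y_def)
    finally show ?thesis by (simp add: Suc)
  qed
qed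

lemma elem_sym_uminus: "elem_sym g n (\<lambda>i. - t i) = (-1) ^ n * elem_sym g n t"
  unfolding elem_sym_def sum_distrib_left
  by (intro sum.cong) (auto simp: prod_uminus)

lemma elem_sym_top: "elem_sym g g t = (\<Prod>i\<in>{1..g}. t i)"
  by (induction g) (simp_all add: elem_sym_Suc_Suc elem_sym_eq_0 prod.nat_ivl_Suc' mult.commute)

lemma prod_add_eq_elem_sym:
  "(\<Prod>i\<in>{1..g}. t i + x) = (\<Sum>m\<le>g. elem_sym g m t * x ^ (g - m))"
  using elem_sym_shift[of g g t x] by (simp add: elem_sym_top)

text \<open>If u_j < 0, the product of all u_i + x vanishes at the positive point x = -u_j, while
  its expansion there has the positive term x^g and otherwise nonnegative terms.\<close>

lemma nonneg_if_elem_sym_nonneg: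
  assumes "\<And>i. i \<in> {1..g} \<Longrightarrow> 0 \<le> elem_sym g i u" and j: "j \<in> {1..g}"
  shows "0 \<le> u j"
proof (rule ccontr)
  assume neg: "\<not> 0 \<le> u j"
  have "0 < (- u j) ^ g"
    using neg by simp
  also have "\<dots> \<le> (\<Sum>m\<le>g. elem_sym g m u * (- u j) ^ (g - m))"
  proof -
    have "0 \<le> (\<Sum>m<g. elem_sym g (Suc m) u * (- u j) ^ (g - Suc m))"
      using neg assms by (intro sum_nonneg mult_nonneg_nonneg zero_le_power) auto
    then show ?thesis
      by (subst sum.atMost_shift) simp
  qed
  also have "\<dots> = (\<Prod>i\<in>{1..g}. u i + - u j)"
    by (rule prod_add_eq_elem_sym[symmetric])
  also have "\<dots> = 0"
    using j by (intro prod_zero) auto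
  finally show False by simp
qed

lemma elem_sym_nonneg:
  assumes "\<And>i. i \<in> {1..g} \<Longrightarrow> 0 \<le> u i"
  shows "0 \<le> elem_sym g n u"
  unfolding elem_sym_def using assms by (intro sum_nonneg prod_nonneg) auto

lemma abs_elem_sym_le:
  assumes "\<And>i. i \<in> {1..g} \<Longrightarrow> \<bar>u i\<bar> \<le> c"
  shows "\<bar>elem_sym g n u\<bar> \<le> c ^ n * real (g choose n)"
proof -
  have "\<bar>elem_sym g n u\<bar> \<le> (\<Sum>B | B \<subseteq> {1..g} \<and> card B = n. \<bar>\<Prod>i\<in>B. u i\<bar>)"
    unfolding elem_sym_def by (rule sum_abs)
  also have "\<dots> \<le> (\<Sum>B | B \<subseteq> {1..g} \<and> card B = n. c ^ n)"
  proof (rule sum_mono, clarify)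
    fix B assume B: "B \<subseteq> {1..g}" "n = card B"
    have "(\<Prod>i\<in>B. \<bar>u i\<bar>) \<le> (\<Prod>i\<in>B. c)"
      using assms B by (intro prod_mono) auto
    then show "\<bar>prod u B\<bar> \<le> c ^ card B"
      by (simp add: abs_prod)
  qed
  also have "\<dots> = c ^ n * real (g choose n)"
    using n_subsets[of "{1..g}" n] by simp
  finally show ?thesis .
qed

lemma s0_viete: "n \<le> g \<Longrightarrow> s0 (viete g t) n = elem_sym g n t"
  by (simp add: s0_def viete_def)

text \<open>The substitution m = i - k identifies the sum with \<open>elem_sym_shift\<close>; i <= g
  is what makes g - i + k equal to g - m for natural numbers.\<close>

lemma L_plus_viete:
  assumes "i \<le> g"
  shows "L_plus g i l (viete g t) = elem_sym g i (\<lambda>j. t j + l)"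
proof -
  have "L_plus g i l (viete g t) =
      (\<Sum>k\<le>i. real ((g - i + k) choose k) * elem_sym g (i - k) t * l ^ k)"
    unfolding L_plus_def atMost_atLeast0[symmetric]
    using assms by (intro sum.cong) (auto simp: s0_viete)
  also have "\<dots> = (\<Sum>m\<le>i. real ((g - m) choose (i - m)) * elem_sym g m t * l ^ (i - m))"
    by (rule sum.reindex_bij_witness[where i = "\<lambda>m. i - m" and j = "\<lambda>m. i - m"]) (use assms in auto)
  finally show ?thesis
    by (simp add: elem_sym_shift)
qed

lemma L_minus_viete:
  assumes "i \<le> g"
  shows "L_minus g i l (viete g t) = elem_sym g i (\<lambda>j. l - t j)"
proof -
  have "L_minus g i l (viete g t) = L_plus g i l (viete g (\<lambda>j. - t j))"
    unfolding L_minus_def L_plus_def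
    using assms by (intro sum.cong) (auto simp: s0_viete elem_sym_uminus)
  then show ?thesis
    by (simp add: L_plus_viete[OF assms] add.commute)
qed

section \<open>The intersection formula and the bounding box\<close>

lemma viete_in_RR: "viete g t \<in> RR g"
  by (simp add: viete_def)

text \<open>The point \<open>t\<close> is arbitrary, so the equivalence serves both inclusions
  between \<Sigma> and \<Theta> \<inter> \<Pi>.\<close>

lemma viete_in_Theta_iff:
  "viete g t \<in> Theta_region g \<longleftrightarrow> (\<forall>i\<in>{1..g}. t i \<in> {-2..2})"
proof
  assume L: "viete g t \<in> Theta_region g"
  show "\<forall>i\<in>{1..g}. t i \<in> {-2..2}"
  proof
    fix j assume j: "j \<in> {1..g}"
    have e: "0 \<le> elem_sym g i (\<lambda>j. t j + 2)" "0 \<le> elem_sym g i (\<lambda>j. 2 - t j)" if "i \<in> {1..g}" for i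
      using L that by (auto simp: Theta_region_def L_plus_viete L_minus_viete)
    have "0 \<le> t j + 2" "0 \<le> 2 - t j"
      using nonneg_if_elem_sym_nonneg[OF e(1) j] nonneg_if_elem_sym_nonneg[OF e(2) j] by auto
    then show "t j \<in> {-2..2}" by simp
  qed
next
  assume "\<forall>i\<in>{1..g}. t i \<in> {-2..2}"
  then have "0 \<le> t i + 2 \<and> 0 \<le> 2 - t i" if "i \<in> {1..g}" for i
    using that by fastforce
  then have "0 \<le> elem_sym g i (\<lambda>j. t j + 2) \<and> 0 \<le> elem_sym g i (\<lambda>j. 2 - t j)" for i
    by (intro conjI elem_sym_nonneg) auto
  then show "viete g t \<in> Theta_region g"
    using viete_in_RR[of g t] by (simp add: Theta_region_def L_plus_viete L_minus_viete)
qed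

lemma Sigma_region_eq: "Sigma_region g = Theta_region g \<inter> Pi_region g"
proof
  show "Sigma_region g \<subseteq> Theta_region g \<inter> Pi_region g"
    unfolding Sigma_region_def Pi_region_def cube_def
    using viete_in_Theta_iff by (fastforce simp: PiE_iff)
  show "Theta_region g \<inter> Pi_region g \<subseteq> Sigma_region g"
    unfolding Sigma_region_def Pi_region_def cube_def
    using viete_in_Theta_iff by (fastforce simp: PiE_iff)
qed

lemma Sigma_region_subset_box:
  "Sigma_region g \<subseteq> (\<Pi>\<^sub>E i\<in>{1..g}. {- (2 ^ i * real (g choose i))..2 ^ i * real (g choose i)})"
proof
  fix s assume "s \<in> Sigma_region g"
  then obtain t where s: "s = viete g t" and t: "t \<in> cube g"
    by (auto simp: Sigma_region_def)
  have "\<bar>elem_sym g i t\<bar> \<le> 2 ^ i * real (g choose i)" for i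
    using t by (intro abs_elem_sym_le) (auto simp: cube_def PiE_iff abs_le_iff minus_le_iff)
  then show "s \<in> (\<Pi>\<^sub>E i\<in>{1..g}. {- (2 ^ i * real (g choose i))..2 ^ i * real (g choose i)})"
    unfolding s viete_def by (auto simp: abs_le_iff minus_le_iff)
qed

subsection \<open>Polynomials with given elementary symmetric coefficients\<close>

text \<open>At \<open>s = viete g t\<close> this is the product of the X - t_j. It is defined for
  every \<open>s\<close>, including those whose polynomial has non-real roots.\<close>

definition viete_poly :: "nat \<Rightarrow> (nat \<Rightarrow> real) \<Rightarrow> real poly" where
  "viete_poly g s = (\<Sum>m\<le>g. Polynomial.monom ((-1) ^ m * s0 s m) (g - m))"

lemma poly_viete_poly: "poly (viete_poly g s) x = (\<Sum>m\<le>g. (-1) ^ m * s0 s m * x ^ (g - m))"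
  by (simp add: viete_poly_def poly_sum poly_monom)

lemma coeff_viete_poly:
  assumes "m \<le> g"
  shows "coeff (viete_poly g s) (g - m) = (-1) ^ m * s0 s m"
proof -
  have "coeff (viete_poly g s) (g - m) = (\<Sum>k\<le>g. if k = m then (-1) ^ k * s0 s k else 0)"
    unfolding viete_poly_def coeff_sum coeff_monom
    by (intro sum.cong) (use assms in auto)
  then show ?thesis
    using assms by simp
qed

lemma degree_viete_poly: "degree (viete_poly g s) = g"
proof (rule antisym)
  show "degree (viete_poly g s) \<le> g"
    unfolding viete_poly_def
    by (rule degree_sum_le) (auto intro: order.trans[OF degree_monom_le])
  show "g \<le> degree (viete_poly g s)"
    using coeff_viete_poly[of 0 g s] by (intro le_degree) (simp add: s0_def)
qed

lemma lead_coeff_viete_poly: "lead_coeff (viete_poly g s) = 1"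
  using coeff_viete_poly[of 0 g s] by (simp add: degree_viete_poly s0_def)

lemma viete_poly_inject:
  assumes "s \<in> RR g" "s' \<in> RR g" "viete_poly g s = viete_poly g s'"
  shows "s = s'"
proof (rule PiE_ext[OF assms(1,2)])
  fix i assume "i \<in> {1..g}"
  then show "s i = s' i"
    using coeff_viete_poly[of i g s] coeff_viete_poly[of i g s'] assms(3) by (simp add: s0_def)
qed

lemma viete_poly_viete:
  "viete_poly g (viete g t) = (\<Prod>x\<in>#image_mset t (mset_set {1..g}). [:- x, 1:])"
proof -
  have "poly (viete_poly g (viete g t)) x = poly (\<Prod>i\<in>{1..g}. [:- t i, 1:]) x" for x
  proof -
    have "poly (viete_poly g (viete g t)) x = (\<Sum>m\<le>g. elem_sym g m (\<lambda>i. - t i) * x ^ (g - m))"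
      unfolding poly_viete_poly by (intro sum.cong) (auto simp: s0_viete elem_sym_uminus)
    also have "\<dots> = (\<Prod>i\<in>{1..g}. - t i + x)"
      by (rule prod_add_eq_elem_sym[symmetric])
    finally show ?thesis
      by (simp add: poly_prod)
  qed
  then have "viete_poly g (viete g t) = (\<Prod>i\<in>{1..g}. [:- t i, 1:])"
    by (intro poly_eq_poly_eq_iff[THEN iffD1] ext)
  then show ?thesis
    by (simp add: prod_unfold_prod_mset image_mset.compositionality comp_def)
qed

lemma prod_mset_linear_nonzero: "(\<Prod>x\<in>#M. [:- x, 1:]) \<noteq> (0 :: 'a::idom poly)"
  by (induction M) (auto simp del: mult_pCons_left)

lemma proots_prod_mset_linear: "proots (\<Prod>x\<in>#M. [:- x, 1 :: 'a::idom:]) = M"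
proof (induction M)
  case (add x M)
  have "[:- x, 1:] * (\<Prod>x\<in>#M. [:- x, 1:]) \<noteq> 0"
    using prod_mset_linear_nonzero[of "add_mset x M"] by simp
  then show ?case
    using add by (simp add: proots_mult del: mult_pCons_left)
qed simp

text \<open>The monic polynomial mediates: it determines the multiset of its roots, and its
  coefficients determine \<open>s\<close>. Hence the fibres of the Viete map are the orbits under
  permutation.\<close>

lemma viete_eq_iff:
  "viete g t = viete g u \<longleftrightarrow> image_mset t (mset_set {1..g}) = image_mset u (mset_set {1..g})"
proof
  have roots: "proots (viete_poly g (viete g v)) = image_mset v (mset_set {1..g})" for v
    unfolding viete_poly_viete by (rule proots_prod_mset_linear)
  assume "viete g t = viete g u"
  then show "image_mset t (mset_set {1..g}) = image_mset u (mset_set {1..g})"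
    using roots[of t] roots[of u] by simp
next
  assume "image_mset t (mset_set {1..g}) = image_mset u (mset_set {1..g})"
  then have "viete_poly g (viete g t) = viete_poly g (viete g u)"
    by (simp only: viete_poly_viete)
  then show "viete g t = viete g u"
    by (rule viete_poly_inject[OF viete_in_RR viete_in_RR])
qed

text \<open>Passes from lists, indexed from 0, to points, indexed from 1.\<close>

lemma image_mset_nth_shift:
  assumes "length xs = g"
  shows "image_mset (\<lambda>i\<in>{1..g}. xs ! (i - 1)) (mset_set {1..g}) = mset xs"
proof -
  have "image_mset (\<lambda>i\<in>{1..g}. xs ! (i - 1)) (mset_set {1..g}) = image_mset (\<lambda>i. xs ! (i - 1)) (mset [1..<Suc g])"
    unfolding mset_upt atLeastLessThanSuc_atLeastAtMost by (intro image_mset_cong) auto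
  also have "\<dots> = mset (map (\<lambda>i. xs ! (i - 1)) (map Suc [0..<g]))"
    by (simp only: map_Suc_upt mset_map One_nat_def)
  also have "map (\<lambda>i. xs ! (i - 1)) (map Suc [0..<g]) = xs"
    using assms map_nth[of xs] by (simp add: comp_def del: map_Suc_upt)
  finally show ?thesis .
qed

lemma in_Pi_region_iff:
  "s \<in> Pi_region g \<longleftrightarrow> s \<in> RR g \<and> (\<exists>M. viete_poly g s = (\<Prod>x\<in>#M. [:- x, 1:]))"
proof
  assume "s \<in> Pi_region g"
  then show "s \<in> RR g \<and> (\<exists>M. viete_poly g s = (\<Prod>x\<in>#M. [:- x, 1:]))"
    unfolding Pi_region_def using viete_poly_viete viete_in_RR by fast
next
  assume *: "s \<in> RR g \<and> (\<exists>M. viete_poly g s = (\<Prod>x\<in>#M. [:- x, 1:]))"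
  then obtain M where M: "viete_poly g s = (\<Prod>x\<in>#M. [:- x, 1:])" by blast
  obtain xs where xs: "mset xs = M" using ex_mset by blast
  have "degree (\<Prod>x\<in>#M. [:- x, 1:]) = size M"
  proof (induction M)
    case (add x M)
    then show ?case
      using prod_mset_linear_nonzero[of M] by (simp add: degree_mult_eq del: mult_pCons_left)
  qed simp
  \<comment> \<open>Comparing degrees shows that the roots fill exactly the coordinates 1 to
    g.\<close>
  then have len: "length xs = g"
    using degree_viete_poly[of g s] unfolding M xs[symmetric] by simp
  define t where "t = (\<lambda>i\<in>{1..g}. xs ! (i - 1))"
  have "viete_poly g (viete g t) = viete_poly g s"
    unfolding viete_poly_viete t_def image_mset_nth_shift[OF len] xs M ..
  then have "viete g t = s"
    using * by (intro viete_poly_inject[OF viete_in_RR]) auto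
  moreover have "t \<in> RR g" by (simp add: t_def)
  ultimately show "s \<in> Pi_region g" unfolding Pi_region_def by blast
qed

section \<open>Ordered representatives of the fibres\<close>

lemma alcove_closure_subset_cube: "alcove_closure g \<subseteq> cube g"
  by (auto simp: alcove_closure_def cube_def PiE_iff extensional_def)

lemma Sigma_region_eq_alcove: "Sigma_region g = viete g ` alcove_closure g"
proof
  show "viete g ` alcove_closure g \<subseteq> Sigma_region g"
    unfolding Sigma_region_def using alcove_closure_subset_cube by blast
  show "Sigma_region g \<subseteq> viete g ` alcove_closure g"
    unfolding Sigma_region_def
  proof safe
    fix t assume t: "t \<in> cube g"
    define xs where "xs = sort (map t [1..<Suc g])"
    have len: "length xs = g" by (simp add: xs_def)
    define u where "u = (\<lambda>i\<in>{1..g}. xs ! (i - 1))"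
    have "image_mset u (mset_set {1..g}) = mset xs"
      unfolding u_def by (rule image_mset_nth_shift[OF len])
    also have "\<dots> = image_mset t (mset_set {1..g})"
      by (simp only: xs_def mset_sort mset_map mset_upt atLeastLessThanSuc_atLeastAtMost)
    finally have "viete g t = viete g u"
      by (simp add: viete_eq_iff)
    moreover have "u \<in> alcove_closure g"
    proof -
      have "set xs \<subseteq> {-2..2}"
        using t by (auto simp: xs_def cube_def PiE_iff)
      then have "xs ! k \<in> {-2..2}" if "k < g" for k
        using that len nth_mem by blast
      moreover have "sorted xs" by (simp add: xs_def)
      ultimately show ?thesis
        by (force simp: alcove_closure_def u_def len intro: sorted_nth_mono)
    qed
    ultimately show "viete g t \<in> viete g ` alcove_closure g" by blast
  qed
qed

text \<open>Equal images mean equal multisets of entries, and a sorted list is determined by its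
  multiset.\<close>

lemma inj_on_viete_alcove: "inj_on (viete g) (alcove_closure g)"
proof (rule inj_onI)
  fix t u assume t: "t \<in> alcove_closure g" and u: "u \<in> alcove_closure g" and "viete g t = viete g u"
  then have "mset (map t [1..<Suc g]) = mset (map u [1..<Suc g])"
    by (simp only: viete_eq_iff mset_map mset_upt atLeastLessThanSuc_atLeastAtMost)
  moreover have "sorted (map v [1..<Suc g])" if "v \<in> alcove_closure g" for v
    using that by (auto simp: alcove_closure_def sorted_iff_nth_mono simp del: upt_Suc)
  ultimately have "map t [1..<Suc g] = map u [1..<Suc g]"
    using t u by (metis properties_for_sort)
  then have "t i = u i" if "i \<in> {1..g}" for i
    using that by (auto simp del: upt_Suc)
  moreover have "t \<in> RR g" "u \<in> RR g" using t u by (auto simp: alcove_closure_def)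
  ultimately show "t = u" by (metis PiE_ext)
qed

subsection \<open>Gram matrices\<close>

lemma coeff_prod_list_nonneg:
  fixes ps :: "real poly list"
  assumes "\<And>p k. p \<in> set ps \<Longrightarrow> 0 \<le> coeff p k"
  shows "0 \<le> coeff (prod_list ps) k"
  using assms
proof (induction ps arbitrary: k)
  case (Cons p ps)
  then show ?case
    by (auto simp: coeff_mult intro!: sum_nonneg mult_nonneg_nonneg)
qed (simp add: coeff_1)

text \<open>Lets the arguments on quadratic forms use finite sums of functions on the naturals; it
  is applied over the reals and over the complex numbers.\<close>

lemma eigenvalue_sum_eq:
  assumes A: "A \<in> carrier_mat n n"
  shows "eigenvalue A k \<longleftrightarrow>
    (\<exists>x. (\<exists>a<n. x a \<noteq> 0) \<and> (\<forall>a<n. (\<Sum>b<n. A $$ (a, b) * x b) = k * x a))"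
proof
  assume "eigenvalue A k"
  then obtain v where v: "v \<in> carrier_vec n" "v \<noteq> 0\<^sub>v n" "A *\<^sub>v v = k \<cdot>\<^sub>v v"
    using A by (auto simp: eigenvalue_def eigenvector_def)
  have "\<exists>a<n. v $ a \<noteq> 0"
    using v(1,2) by (metis carrier_vecD eq_vecI index_zero_vec)
  moreover have "(\<Sum>b<n. A $$ (a, b) * v $ b) = k * v $ a" if "a < n" for a
  proof -
    have "(A *\<^sub>v v) $ a = (\<Sum>b<n. A $$ (a, b) * v $ b)"
      using A v(1) that by (auto simp: scalar_prod_def atLeast0LessThan intro!: sum.cong)
    then show ?thesis
      using v that by auto
  qed
  ultimately show "\<exists>x. (\<exists>a<n. x a \<noteq> 0) \<and> (\<forall>a<n. (\<Sum>b<n. A $$ (a, b) * x b) = k * x a)"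
    by (intro exI[of _ "\<lambda>a. v $ a"]) blast
next
  assume "\<exists>x. (\<exists>a<n. x a \<noteq> 0) \<and> (\<forall>a<n. (\<Sum>b<n. A $$ (a, b) * x b) = k * x a)"
  then obtain x a where x: "a < n" "x a \<noteq> 0"
    and eq: "\<And>a. a < n \<Longrightarrow> (\<Sum>b<n. A $$ (a, b) * x b) = k * x a"
    by blast
  have "eigenvector A (Matrix.vec n x) k"
    unfolding eigenvector_def
  proof (intro conjI)
    show "Matrix.vec n x \<noteq> 0\<^sub>v (dim_row A)"
      using x A by (metis carrier_matD(1) index_vec index_zero_vec(1))
    show "A *\<^sub>v Matrix.vec n x = k \<cdot>\<^sub>v Matrix.vec n x"
    proof (rule eq_vecI)
      fix a assume "a < dim_vec (k \<cdot>\<^sub>v Matrix.vec n x)"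
      then have a: "a < n" by simp
      then have "(A *\<^sub>v Matrix.vec n x) $ a = (\<Sum>b<n. A $$ (a, b) * x b)"
        using A by (auto simp: scalar_prod_def atLeast0LessThan intro!: sum.cong)
      then show "(A *\<^sub>v Matrix.vec n x) $ a = (k \<cdot>\<^sub>v Matrix.vec n x) $ a"
        using eq[OF a] a by simp
    qed (use A in simp)
  qed (use A in auto)
  then show "eigenvalue A k"
    unfolding eigenvalue_def by blast
qed

text \<open>Pairing the eigenvalue equation with the conjugate of x gives a |x|^2 = |w|^2 for w = V
  x, so a is a quotient of nonnegative reals.\<close>

lemma gram_eigenvalue:
  fixes V :: "'i \<Rightarrow> nat \<Rightarrow> real" and a :: complex
  assumes x: "\<exists>j<n. x j \<noteq> 0"
    and eq: "\<And>j. j < n \<Longrightarrow> (\<Sum>b<n. of_real (\<Sum>i\<in>I. V i j * V i b) * x b) = a * x j"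
  shows "\<exists>r\<ge>0. a = of_real r"
proof -
  define S where "S = (\<Sum>j<n. (cmod (x j))\<^sup>2)"
  define w where "w = (\<lambda>i. \<Sum>b<n. of_real (V i b) * x b)"
  define R where "R = (\<Sum>i\<in>I. (cmod (w i))\<^sup>2)"
  have S: "S > 0"
  proof -
    obtain j where "j < n" "x j \<noteq> 0" using x by blast
    then show ?thesis
      unfolding S_def by (intro sum_pos2[of _ j]) auto
  qed
  have "a * of_real S = (\<Sum>j<n. cnj (x j) * (a * x j))"
    by (simp only: S_def of_real_sum complex_norm_square sum_distrib_left) (simp add: mult_ac)
  also have "\<dots> = (\<Sum>j<n. cnj (x j) * (\<Sum>b<n. of_real (\<Sum>i\<in>I. V i j * V i b) * x b))"
    using eq by simp
  also have "\<dots> = (\<Sum>j<n. \<Sum>b<n. \<Sum>i\<in>I. (of_real (V i j) * cnj (x j)) * (of_real (V i b) * x b))"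
    by (simp add: sum_distrib_left sum_distrib_right mult_ac)
  also have "\<dots> = (\<Sum>j<n. \<Sum>i\<in>I. \<Sum>b<n. (of_real (V i j) * cnj (x j)) * (of_real (V i b) * x b))"
    by (intro sum.cong refl sum.swap)
  also have "\<dots> = (\<Sum>i\<in>I. \<Sum>j<n. \<Sum>b<n. (of_real (V i j) * cnj (x j)) * (of_real (V i b) * x b))"
    by (rule sum.swap)
  also have "\<dots> = (\<Sum>i\<in>I. cnj (w i) * w i)"
    by (simp add: w_def sum_product)
  also have "\<dots> = of_real R"
    by (simp only: R_def of_real_sum complex_norm_square mult.commute)
  finally have "a = of_real (R / S)"
    using S by (simp add: field_simps)
  moreover have "R / S \<ge> 0"
    using S by (auto simp: R_def intro!: divide_nonneg_pos sum_nonneg)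
  ultimately show ?thesis by blast
qed

text \<open>The eigenvalues of a Gram matrix are nonnegative reals r, so the characteristic
  polynomial of its negative is a product of factors X + r.\<close>

lemma coeff_char_poly_uminus_gram:
  fixes V :: "'i \<Rightarrow> nat \<Rightarrow> real" and I :: "'i set" and n :: nat
  defines "A \<equiv> Matrix.mat n n (\<lambda>(a, b). \<Sum>i\<in>I. V i a * V i b)"
  shows "0 \<le> coeff (char_poly (- A)) k"
proof -
  define C :: "complex mat" where "C = map_mat of_real (- A)"
  have A: "- A \<in> carrier_mat n n" and C: "C \<in> carrier_mat n n"
    by (auto simp: A_def C_def)
  obtain as where as: "char_poly C = (\<Prod>a\<leftarrow>as. [:- a, 1:])"
    using char_poly_factorized[OF C] by blast
  have neg: "\<exists>r\<ge>0. a = - of_real r" if "a \<in> set as" for a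
  proof -
    have "poly (char_poly C) a = 0"
      using that unfolding as poly_prod_list by (intro prod_list_zero_iff[THEN iffD2]) force
    then have "eigenvalue C a"
      by (simp add: eigenvalue_root_char_poly[OF C])
    then obtain x where x: "\<exists>j<n. x j \<noteq> 0"
      and eq: "\<And>j. j < n \<Longrightarrow> (\<Sum>b<n. C $$ (j, b) * x b) = a * x j"
      unfolding eigenvalue_sum_eq[OF C] by blast
    have "(\<Sum>b<n. of_real (\<Sum>i\<in>I. V i j * V i b) * x b) = - a * x j" if "j < n" for j
    proof -
      have "- (\<Sum>b<n. of_real (\<Sum>i\<in>I. V i j * V i b) * x b) = a * x j"
        using eq[OF that] that by (simp add: C_def A_def sum_negf)
      from arg_cong[OF this, of uminus] show ?thesis by simp
    qed
    from gram_eigenvalue[OF x this] show ?thesis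
      by (metis minus_minus)
  qed
  have real: "[:- a, 1:] = map_poly of_real [:- Re a, 1:] \<and> 0 \<le> - Re a" if "a \<in> set as" for a
    using neg[OF that] by (auto simp: map_poly_pCons)
  interpret of_real_poly: map_poly_comm_ring_hom "of_real :: real \<Rightarrow> complex" ..
  have "map_poly of_real (char_poly (- A)) = char_poly C"
    unfolding C_def by (rule of_real_hom.char_poly_hom[OF A, symmetric])
  also have "\<dots> = (\<Prod>a\<leftarrow>as. map_poly of_real [:- Re a, 1:])"
    unfolding as using real by (intro arg_cong[of _ _ prod_list] map_cong) auto
  also have "\<dots> = map_poly of_real (\<Prod>a\<leftarrow>as. [:- Re a, 1:])"
    by (simp only: of_real_poly.hom_prod_list list.map_comp comp_def)
  finally have "char_poly (- A) = (\<Prod>a\<leftarrow>as. [:- Re a, 1:])"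
    by (simp add: poly_eq_iff coeff_map_poly)
  then show ?thesis
    using real by (auto intro!: coeff_prod_list_nonneg simp: coeff_pCons split: nat.splits)
qed

lemma det_eq_coeff_char_poly_uminus:
  assumes A: "(A :: real mat) \<in> carrier_mat n n"
  shows "Determinant.det A = coeff (char_poly (- A)) 0"
proof -
  have mA: "- A \<in> carrier_mat n n" using A by simp
  have "poly (char_poly (- A)) 0 = Determinant.det (- (char_matrix (- A) 0))"
    by (rule char_poly_matrix[OF mA])
  also have "- (char_matrix (- A) 0) = A"
    using A by (intro eq_matI) (auto simp: char_matrix_def)
  finally show ?thesis by (simp add: poly_0_coeff_0)
qed

text \<open>At \<open>s = viete g t\<close> each minor is the determinant of a Gram matrix with V i
  a = t_i^a, hence a constant coefficient of the kind just shown to be nonnegative.\<close>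

lemma Pi_region_subset_Pi_minors: "Pi_region g \<subseteq> Pi_minors g"
proof
  fix s assume "s \<in> Pi_region g"
  then obtain t where s: "s = viete g t" by (auto simp: Pi_region_def)
  have "0 \<le> meval of_int s (minor_poly g j)" for j
  proof -
    have "Matrix.mat j j (\<lambda>(a, b). power_sum g t (a + b)) =
        Matrix.mat j j (\<lambda>(a, b). \<Sum>i\<in>{1..g}. t i ^ a * t i ^ b)"
      by (simp add: power_sum_def power_add)
    then show ?thesis
      unfolding s minor_poly_viete
      by (simp add: det_eq_coeff_char_poly_uminus[of _ j] coeff_char_poly_uminus_gram)
  qed
  then show "s \<in> Pi_minors g"
    using viete_in_RR by (simp add: Pi_minors_def s)
qed

subsection \<open>Negative directions of symmetric forms\<close>

text \<open>Vectors are functions vanishing from n on, so the sphere is a closed subset of a product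
  of compact intervals and Tychonoff's theorem applies.\<close>

lemma compact_unit_sphere_fun:
  "compact {x :: nat \<Rightarrow> real. (\<forall>a\<ge>n. x a = 0) \<and> (\<Sum>a<n. (x a)\<^sup>2) = 1}"
proof -
  let ?S = "\<lambda>a. if a < n then {-1..1} else {0 :: real}"
  have "compactin (product_topology (\<lambda>_. euclidean) UNIV) (\<Pi>\<^sub>E a\<in>UNIV. ?S a)"
    by (subst compactin_PiE) auto
  then have "compact (\<Pi>\<^sub>E a\<in>UNIV. ?S a)"
    by (simp add: euclidean_product_topology)
  moreover have "closed {x :: nat \<Rightarrow> real. (\<Sum>a<n. (x a)\<^sup>2) = 1}"
    by (intro closed_Collect_eq continuous_on_sum continuous_on_power continuous_on_product_coordinates continuous_on_const)
  ultimately have "compact ((\<Pi>\<^sub>E a\<in>UNIV. ?S a) \<inter> {x. (\<Sum>a<n. (x a)\<^sup>2) = 1})"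
    by (rule compact_Int_closed)
  moreover have "(\<Pi>\<^sub>E a\<in>UNIV. ?S a) \<inter> {x. (\<Sum>a<n. (x a)\<^sup>2) = 1} =
      {x. (\<forall>a\<ge>n. x a = 0) \<and> (\<Sum>a<n. (x a)\<^sup>2) = 1}"
  proof -
    have "x a \<in> ?S a" if "\<forall>a\<ge>n. x a = 0" "(\<Sum>a<n. (x a)\<^sup>2) = 1" for x :: "nat \<Rightarrow> real" and a
    proof (cases "a < n")
      case True
      then have "(x a)\<^sup>2 \<le> (\<Sum>a<n. (x a)\<^sup>2)"
        by (intro member_le_sum) auto
      then have "\<bar>x a\<bar> \<le> 1"
        using that by (simp add: abs_square_le_1)
      then show ?thesis using True by auto
    qed (use that in auto)
    then show ?thesis
      by (auto simp: PiE_iff split: if_splits)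
  qed
  ultimately show ?thesis by simp
qed

text \<open>The first-order condition at a minimum: otherwise a short step against the sign of c
  makes the expression negative.\<close>

lemma linear_coeff_eq_0_if_nonneg:
  fixes c d :: real
  assumes "\<And>e. 0 \<le> 2 * e * c + e\<^sup>2 * d"
  shows "c = 0"
proof (rule ccontr)
  assume c: "c \<noteq> 0"
  \<comment> \<open>Large enough that at e = -c/D the linear term outweighs the quadratic
    one.\<close>
  define D where "D = \<bar>d\<bar> + 1"
  have D: "D > 0" "d < D" by (auto simp: D_def)
  have "2 * (- c / D) * c + (- c / D)\<^sup>2 * d = (c / D)\<^sup>2 * (d - 2 * D)"
    using D by (simp add: field_simps power2_eq_square)
  also have "\<dots> < 0"
    using c D by (intro mult_pos_neg) auto
  finally show False
    using assms[of "- c / D"] by simp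
qed

text \<open>The eigenvalue is the minimum of the Rayleigh quotient.\<close>

lemma symmetric_negative_eigenvalue:
  fixes Q :: "nat \<Rightarrow> nat \<Rightarrow> real"
  assumes sym: "\<And>a b. Q a b = Q b a"
    and neg: "(\<Sum>a<n. \<Sum>b<n. Q a b * v a * v b) < 0"
  shows "\<exists>k<0. \<exists>x. (\<exists>a<n. x a \<noteq> 0) \<and> (\<forall>a<n. (\<Sum>b<n. Q a b * x b) = k * x a)"
proof -
  define q where "q = (\<lambda>x :: nat \<Rightarrow> real. \<Sum>a<n. \<Sum>b<n. Q a b * x a * x b)"
  define N where "N = (\<lambda>x :: nat \<Rightarrow> real. \<Sum>a<n. (x a)\<^sup>2)"
  define K where "K = {x :: nat \<Rightarrow> real. (\<forall>a\<ge>n. x a = 0) \<and> N x = 1}"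
  have "compact K"
    unfolding K_def N_def by (rule compact_unit_sphere_fun)
  \<comment> \<open>By homogeneity the values on the compact sphere control \<open>q\<close>
    everywhere.\<close>
  have scale: "\<exists>y\<in>K. q x = N x * q y" if "N x > 0" for x
  proof
    define r where "r = sqrt (N x)"
    have r: "r > 0" "r\<^sup>2 = N x"
      using that by (auto simp: r_def)
    define y where "y = (\<lambda>a. if a < n then x a / r else 0)"
    have "N y = N x / r\<^sup>2"
      by (simp add: N_def y_def power_divide sum_divide_distrib)
    then show "y \<in> K"
      using that r by (simp add: K_def y_def)
    have "q x = (\<Sum>a<n. \<Sum>b<n. Q a b * (r * y a) * (r * y b))"
      using r by (simp add: q_def y_def)
    also have "\<dots> = r\<^sup>2 * q y"
      by (simp add: q_def sum_distrib_left power2_eq_square mult_ac)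
    finally show "q x = N x * q y"
      by (simp add: r)
  qed
  have N_pos: "N x > 0 \<or> q x = 0" for x
  proof (cases "N x = 0")
    case True
    then have "x a = 0" if "a < n" for a
      using that by (auto simp: N_def sum_nonneg_eq_0_iff)
    then show ?thesis by (simp add: q_def)
  next
    case False
    moreover have "N x \<ge> 0" by (simp add: N_def sum_nonneg)
    ultimately show ?thesis by simp
  qed
  have "N v > 0"
    using N_pos[of v] neg by (auto simp: q_def)
  then obtain u where u: "u \<in> K" "q v = N v * q u"
    using scale by blast
  then have "q u < 0"
    using neg \<open>N v > 0\<close> by (simp add: q_def mult_less_0_iff)
  have "continuous_on K q"
    unfolding q_def
    by (intro continuous_on_sum continuous_on_mult continuous_on_const
        continuous_on_subset[OF continuous_on_product_coordinates subset_UNIV])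
  then obtain x where x: "x \<in> K" and min: "\<And>y. y \<in> K \<Longrightarrow> q x \<le> q y"
    using continuous_attains_inf[OF \<open>compact K\<close>, of q] u(1) by blast
  define k where "k = q x"
  have "k < 0"
    using min[OF u(1)] \<open>q u < 0\<close> by (simp add: k_def)
  have "N x = 1" using x by (simp add: K_def)
  \<comment> \<open>So \<open>q - k N\<close> is nonnegative and vanishes at the minimiser
    \<open>x\<close>.\<close>
  have lower: "k * N z \<le> q z" for z
  proof (cases "N z > 0")
    case True
    then obtain y where "y \<in> K" "q z = N z * q y" using scale by blast
    then show ?thesis
      using min[of y] True by (simp add: k_def mult.commute)
  next
    case False
    then have "q z = 0" "N z = 0"
      using N_pos[of z] sum_nonneg[of "{..<n}" "\<lambda>a. (z a)\<^sup>2"] by (auto simp: N_def)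
    then show ?thesis by simp
  qed
  have "(\<Sum>b<n. Q a b * x b) = k * x a" if a: "a < n" for a
  proof -
    define c where "c = (\<Sum>b<n. Q a b * x b)"
    \<comment> \<open>Move \<open>x\<close> by \<open>e\<close> in coordinate \<open>a\<close>
      alone; the linear term in \<open>e\<close> is twice the defect in row \<open>a\<close> of the
      eigenvalue equation.\<close>
    have "0 \<le> 2 * e * (c - k * x a) + e\<^sup>2 * (Q a a - k)" for e
    proof -
      define d where "d = (\<lambda>b. if b = a then e else 0)"
      have inner: "(\<Sum>b<n. Q c b * d b) = Q c a * e" for c
        using a by (simp add: d_def if_distrib cong: if_cong)
      have outer: "(\<Sum>b<n. d b * f b) = e * f a" for f
        using a by (simp add: d_def if_distrib if_distribR cong: if_cong)
      have "q (\<lambda>b. x b + d b) = (\<Sum>c<n. \<Sum>b<n. Q c b * x c * x b) + (\<Sum>c<n. x c * (\<Sum>b<n. Q c b * d b))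
          + (\<Sum>c<n. d c * (\<Sum>b<n. Q c b * x b)) + (\<Sum>c<n. d c * (\<Sum>b<n. Q c b * d b))"
        by (simp add: q_def algebra_simps sum.distrib sum_distrib_left)
      also have "\<dots> = k + e * c + e * c + e * (Q a a * e)"
      proof -
        have "(\<Sum>b<n. x b * (Q b a * e)) = (\<Sum>b<n. e * (Q a b * x b))"
          by (intro sum.cong refl) (metis sym mult.assoc mult.commute)
        then show ?thesis
          unfolding inner outer by (simp add: k_def q_def c_def sum_distrib_left)
      qed
      finally have 1: "q (\<lambda>b. x b + d b) = k + 2 * e * c + e\<^sup>2 * Q a a"
        by (simp add: power2_eq_square)
      have "N (\<lambda>b. x b + d b) = N x + 2 * (\<Sum>b<n. d b * x b) + (\<Sum>b<n. d b * d b)"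
        by (simp add: N_def power2_eq_square algebra_simps sum.distrib sum_distrib_left)
      also have "\<dots> = 1 + 2 * e * x a + e\<^sup>2"
        unfolding outer \<open>N x = 1\<close> by (simp add: d_def power2_eq_square)
      finally show ?thesis
        using lower[of "\<lambda>b. x b + d b"] unfolding 1 by (simp add: algebra_simps)
    qed
    then have "c - k * x a = 0"
      by (rule linear_coeff_eq_0_if_nonneg)
    then show ?thesis by (simp add: c_def)
  qed
  moreover have "\<exists>a<n. x a \<noteq> 0"
    using \<open>N x = 1\<close> unfolding N_def
    by (metis (mono_tags, lifting) lessThan_iff sum.neutral zero_neq_one zero_power2)
  ultimately show ?thesis
    using \<open>k < 0\<close> by blast
qed

subsection \<open>Hermite's criterion\<close>

text \<open>Newton's identities for the reversed polynomial, whose coefficients already carry the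
  signs. Roots may lie in any integral domain, since complex ones are needed.\<close>

lemma newton_identity_prod_list:
  fixes zs :: "'a::idom list"
  shows "(\<Sum>i<n. coeff (\<Prod>z\<leftarrow>zs. [:1, - z:]) i * (\<Sum>z\<leftarrow>zs. z ^ (n - i))) =
    - (of_nat n * coeff (\<Prod>z\<leftarrow>zs. [:1, - z:]) n)"
proof (induction zs arbitrary: n)
  case Nil
  then show ?case by (cases n) (auto simp: coeff_1)
next
  case (Cons y zs)
  show ?case
  proof (cases n)
    case 0
    then show ?thesis by simp
  next
    case (Suc k)
    define c where "c = coeff (\<Prod>z\<leftarrow>zs. [:1, - z:])"
    define c' where "c' = coeff (\<Prod>z\<leftarrow>y # zs. [:1, - z:])"
    define p where "p = (\<lambda>n. \<Sum>z\<leftarrow>zs. z ^ n)"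
    have IH: "(\<Sum>i<n. c i * p (n - i)) = - (of_nat n * c n)" for n
      unfolding c_def p_def by (rule Cons.IH)
    have c'0: "c' 0 = c 0" and c'S: "c' (Suc i) = c (Suc i) - y * c i" for i
      by (simp_all add: c_def c'_def)
    \<comment> \<open>The effect on coefficients of the new factor 1 - y X.\<close>
    have shift: "(\<Sum>i<Suc k. c' i * f i) = (\<Sum>i<Suc k. c i * f i) - y * (\<Sum>i<k. c i * f (Suc i))" for f
      by (simp only: sum.lessThan_Suc_shift)
        (simp add: c'0 c'S algebra_simps sum.distrib sum_distrib_left sum_subtractf)
    have A: "(\<Sum>i<Suc k. c' i * p (Suc k - i)) = - (of_nat (Suc k) * c (Suc k)) + y * (of_nat k * c k)"
      unfolding shift using IH[of "Suc k"] IH[of k] by simp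
    have "y * (\<Sum>i<k. c i * y ^ (Suc k - Suc i)) = (\<Sum>i<k. c i * y ^ (Suc k - i))"
      by (auto simp: sum_distrib_left Suc_diff_le intro!: sum.cong)
    \<comment> \<open>For the powers of \<open>y\<close> the two sums cancel except for the term i =
      k.\<close>
    then have B: "(\<Sum>i<Suc k. c' i * y ^ (Suc k - i)) = c k * y"
      unfolding shift by simp
    have "(\<Sum>i<n. c' i * (\<Sum>z\<leftarrow>y # zs. z ^ (n - i))) =
        (\<Sum>i<Suc k. c' i * p (Suc k - i)) + (\<Sum>i<Suc k. c' i * y ^ (Suc k - i))"
      by (simp only: Suc sum.distrib[symmetric]) (simp add: p_def algebra_simps)
    also have "\<dots> = - (of_nat n * c' n)"
      unfolding A B Suc c'S by (simp add: algebra_simps)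
    finally show ?thesis by (simp add: c'_def)
  qed
qed

lemma reflect_poly_prod_list_linear:
  "reflect_poly (\<Prod>z\<leftarrow>zs. [:- z, 1 :: 'a::idom:]) = (\<Prod>z\<leftarrow>zs. [:1, - z:])"
proof (induction zs)
  case (Cons y zs)
  have "reflect_poly [:- y, 1:] = [:1, - y:]"
    by (simp add: reflect_poly_def)
  then show ?case
    using Cons by (simp add: reflect_poly_mult del: mult_pCons_left)
qed simp

lemma meval_svar_eq: "meval of_int s (svar g n) = (if n \<in> {1..g} then s n else 0)"
  by (auto simp: svar_def meval_def)

text \<open>The recursion defining \<open>power_sum_poly\<close> is Newton's identity, so for every
  real \<open>s\<close>, even outside the image of the Viete map, it yields the power sums of the
  complex roots.\<close>

lemma meval_power_sum_poly_roots:
  assumes zs: "map_poly complex_of_real (viete_poly g s) = (\<Prod>z\<leftarrow>zs. [:- z, 1:])" and len: "length zs = g"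
  shows "complex_of_real (meval of_int s (power_sum_poly g n)) = (\<Sum>z\<leftarrow>zs. z ^ n)"
proof -
  define c where "c = coeff (\<Prod>z\<leftarrow>zs. [:1, - z:])"
  \<comment> \<open>\<open>svar g 0\<close> is 0, so the constant coefficient 1 is treated apart;
    for i > g both sides are 0.\<close>
  have c_eq: "c i = (-1) ^ i * of_real (if i = 0 then 1 else meval of_int s (svar g i))" for i
  proof -
    have "c i = coeff (reflect_poly (map_poly complex_of_real (viete_poly g s))) i"
      unfolding c_def zs reflect_poly_prod_list_linear ..
    also have "\<dots> = (if i \<le> g then of_real (coeff (viete_poly g s) (g - i)) else 0)"
      by (simp add: coeff_reflect_poly degree_map_poly degree_viete_poly coeff_map_poly)
    also have "\<dots> = (-1) ^ i * of_real (if i = 0 then 1 else meval of_int s (svar g i))"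
      by (auto simp: coeff_viete_poly meval_svar_eq s0_def)
    finally show ?thesis .
  qed
  show ?thesis
  proof (induction n rule: less_induct)
    case (less n)
    show ?case
    proof (cases n)
      case 0
      then show ?thesis by (simp add: power_sum_poly.simps hom_distribs len sum_list_triv)
    next
      case (Suc k)
      let ?q = "\<lambda>n. complex_of_real (meval of_int s (power_sum_poly g n))"
      let ?p = "\<lambda>n. \<Sum>z\<leftarrow>zs. z ^ n"
      have "{..<Suc k} = insert 0 {1..k}" by auto
      then have "c 0 * ?p (Suc k) + (\<Sum>i\<in>{1..k}. c i * ?p (Suc k - i)) = - (of_nat (Suc k) * c (Suc k))"
        using newton_identity_prod_list[of zs "Suc k"] by (simp add: c_def)
      then have p_eq: "?p (Suc k) = - (of_nat (Suc k) * c (Suc k)) - (\<Sum>i\<in>{1..k}. c i * ?p (Suc k - i))"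
        by (simp add: c_eq[of 0] algebra_simps)
      have sum_eq: "(\<Sum>i\<in>{1..k}. c i * ?p (Suc k - i)) = (\<Sum>i\<in>{1..k}. c i * ?q (Suc k - i))"
      proof (intro sum.cong refl arg_cong2[of _ _ _ _ "(*)"])
        fix i assume "i \<in> {1..k}"
        then show "?p (Suc k - i) = ?q (Suc k - i)"
          by (intro less.IH[symmetric]) (auto simp: Suc)
      qed
      have "?q (Suc k) = (-1) ^ k * of_nat (Suc k) * of_real (meval of_int s (svar g (Suc k))) +
          (\<Sum>i\<in>{1..k}. (-1) ^ (i - 1) * of_real (meval of_int s (svar g i)) * ?q (Suc k - i))"
        unfolding meval_power_sum_poly_Suc by simp
      also have "(\<Sum>i\<in>{1..k}. (-1) ^ (i - 1) * of_real (meval of_int s (svar g i)) * ?q (Suc k - i)) =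
          (\<Sum>i\<in>{1..k}. - (c i * ?q (Suc k - i)))"
        by (intro sum.cong refl) (auto simp: c_eq power_eq_if)
      also have "(-1) ^ k * of_nat (Suc k) * of_real (meval of_int s (svar g (Suc k))) =
          - (of_nat (Suc k) * c (Suc k))"
        unfolding c_eq by simp
      finally show ?thesis
        unfolding Suc p_eq sum_eq by (simp only: sum_negf diff_conv_add_uminus)
    qed
  qed
qed

text \<open>If \<open>w\<close> is a non-real root, the quadratic form \<open>\<Sum>z. f(z)\<^sup>2\<close> is negative at the real polynomial
  \<open>f\<close> that takes the values \<open>\<i>\<close> at \<open>w\<close>, \<open>-\<i>\<close> at the conjugate of \<open>w\<close>, and \<open>0\<close> at the other roots.\<close>

lemma roots_real_if_hankel_nonneg:
  assumes zs: "map_poly complex_of_real (viete_poly g s) = (\<Prod>z\<leftarrow>zs. [:- z, 1:])" and len: "length zs = g"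
    and psd: "\<And>v. 0 \<le> (\<Sum>a<g. \<Sum>b<g. meval of_int s (power_sum_poly g (a + b)) * v a * v b)"
    and w: "w \<in> set zs"
  shows "Im w = 0"
proof (rule ccontr)
  assume im: "Im w \<noteq> 0"
  define w' where "w' = cnj w"
  have ww': "w \<noteq> w'"
    using im by (auto simp: w'_def complex_eq_iff)
  have root: "z \<in> set zs \<longleftrightarrow> poly (map_poly complex_of_real (viete_poly g s)) z = 0" for z
    unfolding zs by (auto simp: poly_prod_list prod_list_zero_iff)
  have cnj: "cnj z \<in> set zs" if "z \<in> set zs" for z
    using that unfolding root by (subst real_poly_cnj_root_iff) (auto simp: coeff_map_poly)
  then have w': "w' \<in> set zs"
    using w by (simp add: w'_def)
  define R where "R = set zs - {w, w'}"
  have "set zs = insert w (insert w' R)" "finite R" "w \<notin> insert w' R" "w' \<notin> R"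
    using w w' ww' by (auto simp: R_def)
  then have "card R + 2 = card (set zs)"
    by simp
  \<comment> \<open>Leaves room for a linear factor: \<open>l * h\<close> has degree below g, so g
    coefficients describe it.\<close>
  then have card_R: "card R + 2 \<le> g"
    using card_length[of zs] len by simp
  define h where "h = (\<Prod>z\<in>R. [:- z, 1:])"
  have h_eq_0: "poly h z = 0 \<longleftrightarrow> z \<in> R" for z
    by (auto simp: h_def poly_prod R_def)
  have hw: "poly h w \<noteq> 0" "poly h w' \<noteq> 0"
    by (simp_all add: h_eq_0 R_def)
  have deg_h: "degree h \<le> card R"
    unfolding h_def by (rule order.trans[OF degree_prod_sum_le]) (auto simp: R_def)
  \<comment> \<open>Lagrange interpolation at \<open>w\<close> and \<open>w'\<close>, the prescribed
    values being divided by those of \<open>h\<close>.\<close>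
  define l where "l = Polynomial.smult (\<i> / poly h w / (w - w')) [:- w', 1:] + Polynomial.smult (- \<i> / poly h w' / (w' - w)) [:- w, 1:]"
  define f where "f = l * h"
  have fw: "poly f w = \<i>" "poly f w' = - \<i>"
  proof -
    have "poly [:- x, 1:] y = y - x" for x y :: complex by simp
    note l = l_def poly_add poly_smult this
    have "poly l w = \<i> / poly h w" "poly l w' = - \<i> / poly h w'"
      unfolding l using ww' by simp_all
    then show "poly f w = \<i>" "poly f w' = - \<i>"
      using hw by (simp_all add: f_def)
  qed
  have f0: "poly f z = 0" if "z \<in> R" for z
    using that by (simp add: f_def h_eq_0)
  have "degree l \<le> 1"
    unfolding l_def by (intro degree_add_le order.trans[OF degree_smult_le]) auto
  then have deg_f: "degree f < g"
    using degree_mult_le[of l h] deg_h card_R unfolding f_def by linarith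
  define v where "v = (\<lambda>a. Re (coeff f a))"
  define F where "F = (\<lambda>z :: complex. \<Sum>a<g. of_real (v a) * z ^ a)"
  \<comment> \<open>Taking real parts of coefficients averages \<open>f\<close> with its conjugate
    polynomial. The prescribed values are compatible with conjugation, so they survive.\<close>
  have F_eq: "F z = (poly f z + cnj (poly f (cnj z))) / 2" for z
  proof -
    have f_eq: "poly f z = (\<Sum>a<g. coeff f a * z ^ a)" for z
      unfolding poly_altdef by (rule sum.mono_neutral_left) (use deg_f in \<open>auto simp: coeff_eq_0\<close>)
    have "poly f z + cnj (poly f (cnj z)) = (\<Sum>a<g. (coeff f a + cnj (coeff f a)) * z ^ a)"
      by (simp add: f_eq sum.distrib[symmetric] algebra_simps)
    then show ?thesis
      by (simp add: F_def v_def complex_add_cnj sum_divide_distrib)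
  qed
  have F_sq: "(F z)\<^sup>2 = - of_bool (z \<in> {w, w'})" if z: "z \<in> set zs" for z
  proof -
    have "cnj z \<in> R" if "z \<in> R"
      using that cnj[of z] by (auto simp: R_def w'_def)
    then consider "z = w" | "z = w'" | "z \<in> R" "cnj z \<in> R"
      using z unfolding R_def by blast
    then show ?thesis
    proof cases
      case 1
      then have "F z = \<i>" using fw by (simp add: F_eq w'_def)
      then show ?thesis using 1 by simp
    next
      case 2
      then have "F z = - \<i>" using fw by (simp add: F_eq w'_def)
      then show ?thesis using 2 by simp
    next
      case 3
      then show ?thesis using f0 by (auto simp: F_eq R_def)
    qed
  qed
  \<comment> \<open>Inserting the power sums of the roots, with multiplicity, turns the Hankel form
    into a sum of squares of values of \<open>F\<close>.\<close>
  have "complex_of_real (\<Sum>a<g. \<Sum>b<g. meval of_int s (power_sum_poly g (a + b)) * v a * v b) =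
      (\<Sum>a<g. \<Sum>b<g. \<Sum>k<g. (of_real (v a) * zs ! k ^ a) * (of_real (v b) * zs ! k ^ b))"
    by (simp add: meval_power_sum_poly_roots[OF zs len] sum_list_sum_nth len atLeast0LessThan
        sum_distrib_left sum_distrib_right power_add mult_ac)
  also have "\<dots> = (\<Sum>a<g. \<Sum>k<g. \<Sum>b<g. (of_real (v a) * zs ! k ^ a) * (of_real (v b) * zs ! k ^ b))"
    by (intro sum.cong refl sum.swap)
  also have "\<dots> = (\<Sum>k<g. \<Sum>a<g. \<Sum>b<g. (of_real (v a) * zs ! k ^ a) * (of_real (v b) * zs ! k ^ b))"
    by (rule sum.swap)
  also have "\<dots> = (\<Sum>k<g. (F (zs ! k))\<^sup>2)"
    by (simp add: F_def sum_product power2_eq_square)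
  also have "\<dots> = of_real (\<Sum>k<g. - of_bool (zs ! k \<in> {w, w'}))"
    unfolding of_real_sum by (intro sum.cong) (use len in \<open>auto simp: F_sq\<close>)
  finally have "(\<Sum>a<g. \<Sum>b<g. meval of_int s (power_sum_poly g (a + b)) * v a * v b) =
      - (\<Sum>k<g. of_bool (zs ! k \<in> {w, w'}))"
    unfolding of_real_eq_iff by (simp only: sum_negf)
  moreover have "(\<Sum>k<g. of_bool (zs ! k \<in> {w, w'}) :: real) > 0"
  proof -
    obtain k where "k < g" "zs ! k = w" using w len by (metis in_set_conv_nth)
    then show ?thesis by (intro sum_pos2[of _ k]) auto
  qed
  ultimately show False
    using psd[of v] by linarith
qed

text \<open>All g complex roots are real, so the complex factorization descends to the
  reals.\<close>

lemma Pi_region_if_hankel_nonneg: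
  assumes s: "s \<in> RR g"
    and psd: "\<And>v. 0 \<le> (\<Sum>a<g. \<Sum>b<g. meval of_int s (power_sum_poly g (a + b)) * v a * v b)"
  shows "s \<in> Pi_region g"
proof -
  let ?P = "map_poly complex_of_real (viete_poly g s)"
  obtain zs where zs: "Polynomial.smult (lead_coeff ?P) (\<Prod>z\<leftarrow>zs. [:- z, 1:]) = ?P" and len: "length zs = degree ?P"
    using fundamental_theorem_algebra_factorized[of ?P] by blast
  have "degree ?P = g" "lead_coeff ?P = 1"
    using lead_coeff_viete_poly[of g s] by (auto simp: degree_map_poly degree_viete_poly coeff_map_poly)
  then have zs: "?P = (\<Prod>z\<leftarrow>zs. [:- z, 1:])" and len: "length zs = g"
    using zs len by auto
  interpret of_real_poly: map_poly_comm_ring_hom "of_real :: real \<Rightarrow> complex" ..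
  have "Im z = 0" if "z \<in> set zs" for z
    by (rule roots_real_if_hankel_nonneg[OF zs len psd that])
  then have "[:- z, 1:] = map_poly of_real [:- Re z, 1:]" if "z \<in> set zs" for z
    using that by (auto simp: map_poly_pCons complex_eq_iff)
  then have "?P = (\<Prod>z\<leftarrow>zs. map_poly of_real [:- Re z, 1:])"
    unfolding zs by (intro arg_cong[of _ _ prod_list] map_cong) auto
  also have "\<dots> = map_poly of_real (\<Prod>z\<leftarrow>zs. [:- Re z, 1:])"
    by (simp only: of_real_poly.hom_prod_list list.map_comp comp_def)
  finally have "viete_poly g s = (\<Prod>z\<leftarrow>zs. [:- Re z, 1:])"
    by (simp add: poly_eq_iff coeff_map_poly)
  also have "\<dots> = (\<Prod>x\<in>#mset (map Re zs). [:- x, 1:])"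
    by (simp add: prod_mset_prod_list[symmetric] image_mset.compositionality comp_def)
  finally show ?thesis
    using s in_Pi_region_iff by blast
qed

subsection \<open>Semialgebraicity\<close>

text \<open>A predicate on functions, so that closure rules replace explicit polynomials. Integer
  coefficients fit the ring homomorphism \<open>meval of_int\<close>;
  \<open>semialgebraic_pos\<close> makes them real.\<close>

definition int_poly_fun :: "nat \<Rightarrow> ((nat \<Rightarrow> real) \<Rightarrow> real) \<Rightarrow> bool" where
  "int_poly_fun g f \<longleftrightarrow> (\<exists>p :: int mpoly. in_vars g p \<and> (\<forall>x. meval of_int x p = f x))"

lemma int_poly_funI: "in_vars g p \<Longrightarrow> (\<And>x. meval of_int x p = f x) \<Longrightarrow> int_poly_fun g f"
  unfolding int_poly_fun_def by blast

lemma int_poly_fun_const: "int_poly_fun g (\<lambda>x. of_int c)"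
  by (rule int_poly_funI[where p = "Poly_Mapping.single 0 c"]) (auto simp: in_vars_def meval_def)

lemma int_poly_fun_of_nat: "int_poly_fun g (\<lambda>x. real n)"
  using int_poly_fun_const[of g "int n"] by simp

lemma int_poly_fun_0: "int_poly_fun g (\<lambda>x. 0)" and int_poly_fun_1: "int_poly_fun g (\<lambda>x. 1)"
  using int_poly_fun_const[of g 0] int_poly_fun_const[of g 1] by simp_all

lemma int_poly_fun_var: "i \<in> {1..g} \<Longrightarrow> int_poly_fun g (\<lambda>x. x i)"
  by (rule int_poly_funI[where p = "Poly_Mapping.single (Poly_Mapping.single i 1) 1"])
    (auto simp: in_vars_def meval_def)

lemma int_poly_fun_add:
  assumes "int_poly_fun g f" "int_poly_fun g h"
  shows "int_poly_fun g (\<lambda>x. f x + h x)"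
proof -
  obtain p q :: "int mpoly" where p: "in_vars g p" "\<And>x. meval of_int x p = f x"
    and q: "in_vars g q" "\<And>x. meval of_int x q = h x"
    using assms unfolding int_poly_fun_def by blast
  have "in_vars g (p + q)"
    using p(1) q(1) Poly_Mapping.keys_add[of p q] unfolding in_vars_def by blast
  then show ?thesis
    by (rule int_poly_funI) (simp add: meval_int.hom_add p q)
qed

lemma int_poly_fun_mult:
  assumes "int_poly_fun g f" "int_poly_fun g h"
  shows "int_poly_fun g (\<lambda>x. f x * h x)"
proof -
  obtain p q :: "int mpoly" where p: "in_vars g p" "\<And>x. meval of_int x p = f x"
    and q: "in_vars g q" "\<And>x. meval of_int x q = h x"
    using assms unfolding int_poly_fun_def by blast
  have "in_vars g (p * q)"
    unfolding in_vars_def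
  proof
    fix m assume "m \<in> Poly_Mapping.keys (p * q)"
    then obtain a b where "m = a + b" "a \<in> Poly_Mapping.keys p" "b \<in> Poly_Mapping.keys q"
      using Poly_Mapping.keys_mult[of p q] by blast
    then show "Poly_Mapping.keys m \<subseteq> {1..g}"
      using p(1) q(1) Poly_Mapping.keys_add[of a b] unfolding in_vars_def by blast
  qed
  then show ?thesis
    by (rule int_poly_funI) (simp add: meval_int.hom_mult p q)
qed

lemma int_poly_fun_uminus:
  assumes "int_poly_fun g f"
  shows "int_poly_fun g (\<lambda>x. - f x)"
  using int_poly_fun_mult[OF int_poly_fun_const[of g "-1"] assms] by simp

lemma int_poly_fun_sum:
  assumes "\<And>i. i \<in> I \<Longrightarrow> int_poly_fun g (f i)"
  shows "int_poly_fun g (\<lambda>x. \<Sum>i\<in>I. f i x)"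
  using assms
  by (induction I rule: infinite_finite_induct) (auto intro: int_poly_fun_0 int_poly_fun_add)

lemma int_poly_fun_power_sum_poly: "int_poly_fun g (\<lambda>s. meval of_int s (power_sum_poly g n))"
proof (induction n rule: less_induct)
  case (less n)
  show ?case
  proof (cases n)
    case 0
    then show ?thesis
      using int_poly_fun_of_nat[of g g] by (simp add: power_sum_poly.simps hom_distribs)
  next
    case (Suc k)
    have svar: "int_poly_fun g (\<lambda>s. meval of_int s (svar g i))" for i
      by (cases "i \<in> {1..g}") (simp_all only: meval_svar_eq if_True if_False int_poly_fun_var int_poly_fun_0)
    have sign: "int_poly_fun g (\<lambda>x. (-1) ^ i)" for i
      using int_poly_fun_const[of g "(-1) ^ i"] by simp
    show ?thesis
      unfolding Suc meval_power_sum_poly_Suc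
      by (intro int_poly_fun_add int_poly_fun_sum int_poly_fun_mult sign int_poly_fun_of_nat svar less.IH)
        (auto simp: Suc)
  qed
qed

lemma semialgebraic_pos:
  assumes "int_poly_fun g f"
  shows "{x \<in> RR g. 0 < f x} \<in> semialgebraic_sets g"
proof -
  obtain p :: "int mpoly" where p: "in_vars g p" "\<And>x. meval of_int x p = f x"
    using assms unfolding int_poly_fun_def by blast
  define P :: "real mpoly" where "P = Poly_Mapping.map of_int p"
  have lookup: "Poly_Mapping.lookup P m = of_int (Poly_Mapping.lookup p m)" for m
    by (simp add: P_def Poly_Mapping.map.rep_eq when_def)
  have keys: "Poly_Mapping.keys P = Poly_Mapping.keys p"
    by (auto simp: in_keys_iff lookup)
  have "meval (\<lambda>c. c) x P = f x" for x
    unfolding p(2)[symmetric] meval_def keys lookup ..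
  moreover have "in_vars g P"
    using p(1) by (simp add: in_vars_def keys)
  ultimately show ?thesis
    using semialgebraic_sets.pos[of g P] by simp
qed

lemma semialgebraic_nonneg:
  assumes "int_poly_fun g f"
  shows "{x \<in> RR g. 0 \<le> f x} \<in> semialgebraic_sets g"
proof -
  have "{x \<in> RR g. 0 \<le> f x} = RR g - {x \<in> RR g. 0 < - f x}"
    by auto
  then show ?thesis
    using semialgebraic_sets.compl[OF semialgebraic_pos[OF int_poly_fun_uminus[OF assms]]] by simp
qed

lemma semialgebraic_Ball:
  assumes "finite I" "\<And>i. i \<in> I \<Longrightarrow> {x \<in> RR g. P i x} \<in> semialgebraic_sets g"
  shows "{x \<in> RR g. \<forall>i\<in>I. P i x} \<in> semialgebraic_sets g"
  using assms
proof (induction I)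
  case empty
  \<comment> \<open>The whole space is the set where 0 < 1.\<close>
  then show ?case using semialgebraic_pos[OF int_poly_fun_1, of g] by simp
next
  case (insert i I)
  have "{x \<in> RR g. \<forall>i\<in>insert i I. P i x} = {x \<in> RR g. P i x} \<inter> {x \<in> RR g. \<forall>i\<in>I. P i x}"
    by auto
  then show ?case
    using insert by (auto intro: semialgebraic_sets.inter)
qed

lemma semialgebraic_Theta_region: "Theta_region g \<in> semialgebraic_sets g"
proof -
  have s0: "int_poly_fun g (\<lambda>s. s0 s n)" if "n \<le> g" for n
    using that by (cases "n = 0") (simp_all add: s0_def int_poly_fun_1 int_poly_fun_var)
  have const: "int_poly_fun g (\<lambda>x. (-1) ^ n)" "int_poly_fun g (\<lambda>x. 2 ^ n)" for n
    using int_poly_fun_const[of g "(-1) ^ n"] int_poly_fun_const[of g "2 ^ n"] by simp_all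
  have "int_poly_fun g (L_plus g i 2)" "int_poly_fun g (L_minus g i 2)" if "i \<le> g" for i
    unfolding L_plus_def L_minus_def
    by (intro int_poly_fun_sum int_poly_fun_mult int_poly_fun_of_nat const s0; use that in simp)+
  then have "{s \<in> RR g. 0 \<le> L_plus g i 2 s} \<inter> {s \<in> RR g. 0 \<le> L_minus g i 2 s} \<in> semialgebraic_sets g"
    if "i \<le> g" for i
    using that by (intro semialgebraic_sets.inter semialgebraic_nonneg)
  moreover have "{s \<in> RR g. 0 \<le> L_plus g i 2 s} \<inter> {s \<in> RR g. 0 \<le> L_minus g i 2 s} =
      {s \<in> RR g. 0 \<le> L_plus g i 2 s \<and> 0 \<le> L_minus g i 2 s}" for i
    by blast
  ultimately have "{s \<in> RR g. 0 \<le> L_plus g i 2 s \<and> 0 \<le> L_minus g i 2 s} \<in> semialgebraic_sets g"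
    if "i \<le> g" for i
    using that by simp
  then show ?thesis
    unfolding Theta_region_def by (intro semialgebraic_Ball) auto
qed

section \<open>Hermite's criterion as finitely many polynomial inequalities\<close>

definition hankel :: "nat \<Rightarrow> (nat \<Rightarrow> real) \<Rightarrow> real mat" where
  "hankel g s = Matrix.mat g g (\<lambda>(a, b). meval of_int s (power_sum_poly g (a + b)))"

lemma hankel_carrier: "hankel g s \<in> carrier_mat g g"
  by (simp add: hankel_def)

text \<open>On the image of the Viete map the matrix is a Gram matrix. Conversely, a negative value
  of the form gives an eigenvalue k < 0, making -k > 0 a root of a monic polynomial with nonnegative
  coefficients, which is impossible.\<close>

lemma Pi_region_eq_char_poly_nonneg:
  "Pi_region g = {s \<in> RR g. \<forall>k\<in>{..g}. 0 \<le> coeff (char_poly (- hankel g s)) k}"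
proof (intro equalityI subsetI)
  fix s assume "s \<in> Pi_region g"
  then obtain t where s: "s = viete g t" by (auto simp: Pi_region_def)
  have "hankel g s = Matrix.mat g g (\<lambda>(a, b). \<Sum>i\<in>{1..g}. t i ^ a * t i ^ b)"
    by (simp add: hankel_def s meval_power_sum_poly power_sum_def power_add)
  then show "s \<in> {s \<in> RR g. \<forall>k\<in>{..g}. 0 \<le> coeff (char_poly (- hankel g s)) k}"
    using viete_in_RR[of g t] by (simp add: coeff_char_poly_uminus_gram s)
next
  fix s assume "s \<in> {s \<in> RR g. \<forall>k\<in>{..g}. 0 \<le> coeff (char_poly (- hankel g s)) k}"
  then have s: "s \<in> RR g" and nonneg: "\<And>k. k \<le> g \<Longrightarrow> 0 \<le> coeff (char_poly (- hankel g s)) k"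
    by auto
  let ?q = "\<lambda>a b. meval of_int s (power_sum_poly g (a + b))"
  have carrier: "- hankel g s \<in> carrier_mat g g"
    using hankel_carrier by simp
  show "s \<in> Pi_region g"
  proof (rule Pi_region_if_hankel_nonneg[OF s], rule ccontr)
    fix v :: "nat \<Rightarrow> real"
    assume "\<not> 0 \<le> (\<Sum>a<g. \<Sum>b<g. ?q a b * v a * v b)"
    then obtain k x where k: "k < 0" and x: "\<exists>a<g. x a \<noteq> 0"
      and eq: "\<And>a. a < g \<Longrightarrow> (\<Sum>b<g. ?q a b * x b) = k * x a"
      using symmetric_negative_eigenvalue[of ?q v g] by (auto simp: add.commute)
    have "(\<Sum>b<g. (- hankel g s) $$ (a, b) * x b) = - k * x a" if "a < g" for a
      using eq[OF that] that by (simp add: hankel_def sum_negf)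
    then have "poly (char_poly (- hankel g s)) (- k) = 0"
      using x unfolding eigenvalue_root_char_poly[OF carrier, symmetric] eigenvalue_sum_eq[OF carrier]
      by blast
    moreover have "0 < poly (char_poly (- hankel g s)) (- k)"
      unfolding poly_altdef
      using degree_monic_char_poly[OF carrier] k nonneg
      by (intro sum_pos2[of _ g]) (auto intro!: mult_nonneg_nonneg)
    ultimately show False by simp
  qed
qed

lemma int_poly_fun_coeff_mult:
  assumes "\<And>k. int_poly_fun g (\<lambda>x. coeff (P x) k)" "\<And>k. int_poly_fun g (\<lambda>x. coeff (Q x) k)"
  shows "int_poly_fun g (\<lambda>x. coeff (P x * Q x) k)"
  unfolding coeff_mult by (intro int_poly_fun_sum int_poly_fun_mult assms)

lemma int_poly_fun_coeff_prod:
  assumes "\<And>i k. i \<in> I \<Longrightarrow> int_poly_fun g (\<lambda>x. coeff (P i x) k)"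
  shows "int_poly_fun g (\<lambda>x. coeff (\<Prod>i\<in>I. P i x) k)"
  using assms
proof (induction I arbitrary: k rule: infinite_finite_induct)
  case (insert i I)
  then show ?case by (auto intro!: int_poly_fun_coeff_mult)
qed (auto simp: coeff_1 int_poly_fun_0 int_poly_fun_1)

text \<open>By the Leibniz formula the coefficients are built from the matrix entries by sums and
  products.\<close>

lemma int_poly_fun_coeff_char_poly:
  "int_poly_fun g (\<lambda>s. coeff (char_poly (- hankel g s)) k)"
proof -
  \<comment> \<open>The entries of X I + H, the characteristic matrix of -H.\<close>
  define E :: "nat \<Rightarrow> nat \<Rightarrow> (nat \<Rightarrow> real) \<Rightarrow> real poly" where
    "E = (\<lambda>i j s. (if i = j then [:0, 1:] else 0) + [:meval of_int s (power_sum_poly g (i + j)):])"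
  have E: "int_poly_fun g (\<lambda>s. coeff (E i j s) k)" for i j k
    unfolding E_def coeff_add
    by (intro int_poly_fun_add; cases k; cases "i = j"; cases "k = 1")
      (auto simp: coeff_pCons int_poly_fun_0 int_poly_fun_1 int_poly_fun_power_sum_poly split: nat.split)
  have sign: "int_poly_fun g (\<lambda>s. coeff (signof \<pi>) k)" for \<pi> k
  proof -
    have "coeff (signof \<pi> :: real poly) k = of_int (if k = 0 then signof \<pi> else 0)"
      by (simp add: sign_def)
    then show ?thesis by (simp only: int_poly_fun_const)
  qed
  have "char_poly (- hankel g s) = (\<Sum>\<pi> | \<pi> permutes {0..<g}. signof \<pi> * (\<Prod>i = 0..<g. E i (\<pi> i) s))" for s
  proof -
    have carrier: "char_poly_matrix (- hankel g s) \<in> carrier_mat g g"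
      by (simp add: char_poly_matrix_def hankel_def)
    have "(\<Prod>i = 0..<g. char_poly_matrix (- hankel g s) $$ (i, \<pi> i)) = (\<Prod>i = 0..<g. E i (\<pi> i) s)"
      if "\<pi> permutes {0..<g}" for \<pi>
    proof (rule prod.cong)
      fix i assume i: "i \<in> {0..<g}"
      then have "\<pi> i \<in> {0..<g}" using permutes_in_image[OF that] by blast
      with i show "char_poly_matrix (- hankel g s) $$ (i, \<pi> i) = E i (\<pi> i) s"
        by (simp add: char_poly_matrix_def hankel_def E_def)
    qed simp
    then show ?thesis
      unfolding char_poly_def det_def'[OF carrier] by (intro sum.cong) auto
  qed
  then show ?thesis
    by (simp only: coeff_sum) (intro int_poly_fun_sum int_poly_fun_coeff_mult int_poly_fun_coeff_prod sign E)
qed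

lemma semialgebraic_Pi_region: "Pi_region g \<in> semialgebraic_sets g"
  unfolding Pi_region_eq_char_poly_nonneg
  by (intro semialgebraic_Ball semialgebraic_nonneg int_poly_fun_coeff_char_poly) simp

lemma semialgebraic_Sigma_region: "Sigma_region g \<in> semialgebraic_sets g"
  unfolding Sigma_region_eq
  by (intro semialgebraic_sets.inter semialgebraic_Theta_region semialgebraic_Pi_region)

subsection \<open>The simplex\<close>

text \<open>Partial sums turn barycentric coordinates into an increasing sequence in \<open>[-2, 2]\<close>.\<close>

definition alcove_of_simplex :: "nat \<Rightarrow> (nat \<Rightarrow> real) \<Rightarrow> nat \<Rightarrow> real" where
  "alcove_of_simplex g x = (\<lambda>i\<in>{1..g}. -2 + 4 * (\<Sum>k<i. x k))"

lemma alcove_of_simplex_in_alcove: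
  assumes x: "x \<in> standard_simplex g"
  shows "alcove_of_simplex g x \<in> alcove_closure g"
proof -
  have nonneg: "0 \<le> x k" and sum: "(\<Sum>k\<le>g. x k) = 1" for k
    using x by (auto simp: standard_simplex_def)
  have mono: "(\<Sum>k<i. x k) \<le> (\<Sum>k<j. x k)" if "i \<le> j" for i j
    using that nonneg by (intro sum_mono2) auto
  have "0 \<le> (\<Sum>k<i. x k)" "(\<Sum>k<i. x k) \<le> 1" if "i \<le> g" for i
    using mono[of 0 i] mono[of i "Suc g"] that sum by (auto simp: lessThan_Suc_atMost)
  then show ?thesis
    using mono by (auto simp: alcove_closure_def alcove_of_simplex_def)
qed

lemma inj_on_alcove_of_simplex: "inj_on (alcove_of_simplex g) (standard_simplex g)"
proof (rule inj_onI)
  fix x y assume x: "x \<in> standard_simplex g" and y: "y \<in> standard_simplex g"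
    and eq: "alcove_of_simplex g x = alcove_of_simplex g y"
  \<comment> \<open>The alcove point records the sums for i from 1 to g; the sum at
    \<open>Suc g\<close> is 1 on the simplex. Differences then recover every coordinate.\<close>
  have sums: "(\<Sum>k<i. x k) = (\<Sum>k<i. y k)" if i: "i \<le> Suc g" for i
  proof -
    consider "i = 0" | "i \<in> {1..g}" | "i = Suc g" using i by force
    then show ?thesis
    proof cases
      case 2
      then show ?thesis using fun_cong[OF eq, of i] by (simp add: alcove_of_simplex_def)
    next
      case 3
      then show ?thesis using x y by (simp only: lessThan_Suc_atMost) (simp add: standard_simplex_def)
    qed simp
  qed
  show "x = y"
  proof
    fix k show "x k = y k"
    proof (cases "k \<le> g")
      case True
      then show ?thesis using sums[of k] sums[of "Suc k"] by simp
    next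
      case False
      then show ?thesis using x y by (simp add: standard_simplex_def)
    qed
  qed
qed

lemma alcove_of_simplex_image: "alcove_of_simplex g ` standard_simplex g = alcove_closure g"
proof (intro equalityI subsetI)
  fix t assume t: "t \<in> alcove_closure g"
  \<comment> \<open>Padding \<open>t\<close> by the endpoints -2 and 2 gives g + 1 increments of
    total length 4, the barycentric coordinates after division by 4.\<close>
  define u where "u = (\<lambda>i. if i = 0 then -2 else if i \<le> g then t i else 2)"
  define x where "x = (\<lambda>k. if k \<le> g then (u (Suc k) - u k) / 4 else 0)"
  have sum: "(\<Sum>k<i. x k) = (u i - u 0) / 4" if "i \<le> Suc g" for i
  proof -
    have "(\<Sum>k<i. x k) = (\<Sum>k<i. u (Suc k) - u k) / 4"
      unfolding sum_divide_distrib by (intro sum.cong) (use that in \<open>auto simp: x_def\<close>)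
    then show ?thesis by (simp add: sum_lessThan_telescope)
  qed
  have nonneg: "0 \<le> x k" for k
    using t by (auto simp: x_def u_def alcove_closure_def)
  have sum_1: "(\<Sum>k\<le>g. x k) = 1"
    using sum[of "Suc g"] by (simp add: lessThan_Suc_atMost u_def del: sum.lessThan_Suc)
  have "x k \<le> 1" for k
  proof (cases "k \<le> g")
    case True
    then show ?thesis
      using member_le_sum[of k "{..g}" x] nonneg sum_1 by simp
  qed (simp add: x_def)
  then have "x \<in> standard_simplex g"
    using nonneg sum_1 by (simp add: standard_simplex_def x_def)
  moreover have "alcove_of_simplex g x = t"
  proof (rule PiE_ext)
    show "t \<in> RR g" using t by (simp add: alcove_closure_def)
    show "alcove_of_simplex g x i = t i" if "i \<in> {1..g}" for i
      using sum[of i] that by (simp add: alcove_of_simplex_def u_def)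
  qed (simp add: alcove_of_simplex_def)
  ultimately show "t \<in> alcove_of_simplex g ` standard_simplex g" by blast
qed (use alcove_of_simplex_in_alcove in blast)

lemma continuous_map_viete_alcove_of_simplex:
  "continuous_map (powertop_real UNIV) (powertop_real {1..g}) (\<lambda>x. viete g (alcove_of_simplex g x))"
proof -
  have "continuous_on UNIV (\<lambda>x. viete g (alcove_of_simplex g x) i)" if "i \<in> {1..g}" for i
  proof -
    have eq: "viete g (alcove_of_simplex g x) i = elem_sym g i (\<lambda>i. -2 + 4 * (\<Sum>k<i. x k))" for x
      using that by (auto simp: viete_def alcove_of_simplex_def intro!: elem_sym_cong)
    show ?thesis
      unfolding eq elem_sym_def
      by (intro continuous_on_sum continuous_on_prod continuous_on_add continuous_on_mult
          continuous_on_const continuous_on_product_coordinates)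
  qed
  then show ?thesis
    by (simp add: continuous_map_componentwise euclidean_product_topology viete_def image_subset_iff)
qed

text \<open>A continuous bijection from a compact space onto a Hausdorff space is a
  homeomorphism.\<close>

lemma Sigma_region_homeomorphic_simplex:
  "subtopology (powertop_real {1..g}) (Sigma_region g) homeomorphic_space
    subtopology (powertop_real UNIV) (standard_simplex g)"
proof -
  let ?F = "\<lambda>x. viete g (alcove_of_simplex g x)"
  let ?X = "subtopology (powertop_real UNIV) (standard_simplex g)"
  let ?Y = "subtopology (powertop_real {1..g}) (Sigma_region g)"
  have image: "?F ` standard_simplex g = Sigma_region g"
    unfolding Sigma_region_eq_alcove alcove_of_simplex_image[symmetric] by (simp add: image_image)
  have "Sigma_region g \<subseteq> RR g"
    using viete_in_RR by (auto simp: Sigma_region_def)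
  then have top: "topspace ?Y = Sigma_region g"
    by (simp add: Int_absorb1)
  have "homeomorphic_map ?X ?Y ?F"
  proof (rule continuous_imp_homeomorphic_map)
    show "continuous_map ?X ?Y ?F"
      using continuous_map_viete_alcove_of_simplex image
      by (auto simp: continuous_map_in_subtopology continuous_map_from_subtopology)
    show "compact_space ?X"
      using compactin_standard_simplex by (simp add: compact_space_subtopology)
    show "Hausdorff_space ?Y"
      by (intro Hausdorff_space_subtopology) (simp add: Hausdorff_space_product_topology)
    show "?F ` topspace ?X = topspace ?Y"
      by (simp only: topspace_standard_simplex image top)
    show "inj_on ?F (topspace ?X)"
      unfolding topspace_standard_simplex
      using comp_inj_on[OF inj_on_alcove_of_simplex, of "viete g" g] inj_on_viete_alcove[of g]
      by (simp add: alcove_of_simplex_image comp_def)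
  qed
  then show ?thesis
    using homeomorphic_map_imp_homeomorphic_space homeomorphic_space_sym by blast
qed

subsection \<open>At most three variables\<close>

lemma Pi_regionI_prod_list:
  assumes "s \<in> RR g" "viete_poly g s = (\<Prod>x\<leftarrow>xs. [:- x, 1:])"
  shows "s \<in> Pi_region g"
proof -
  have "viete_poly g s = (\<Prod>x\<in>#mset xs. [:- x, 1:])"
    by (simp add: assms(2) prod_mset_prod_list[symmetric])
  then show ?thesis
    using assms(1) in_Pi_region_iff by blast
qed

lemma monic_quadratic_splits:
  fixes b c :: real
  assumes "0 \<le> b\<^sup>2 - 4 * c"
  obtains x y where "[:c, - b, 1:] = [:- x, 1:] * [:- y, 1:]"
proof
  define r where "r = sqrt (b\<^sup>2 - 4 * c)"
  have "r\<^sup>2 = b\<^sup>2 - 4 * c" using assms by (simp add: r_def)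
  then show "[:c, - b, 1:] = [:- ((b + r) / 2), 1:] * [:- ((b - r) / 2), 1:]"
    by (simp add: power2_eq_square field_simps)
qed

lemma Pi_region_1: "s \<in> RR 1 \<Longrightarrow> s \<in> Pi_region 1"
  by (rule Pi_regionI_prod_list[where xs = "[s 1]"])
    (simp_all add: viete_poly_def s0_def monom_altdef)

lemma det_mat_2:
  fixes f :: "nat \<times> nat \<Rightarrow> 'a::comm_ring_1"
  shows "Determinant.det (Matrix.mat 2 2 f) = f (0, 0) * f (1, 1) - f (0, 1) * f (1, 0)"
proof -
  have S: "{0..<2} = {0, 1 :: nat}" by auto
  have f: "finite {1 :: nat}" "0 \<notin> {1 :: nat}" by auto
  show ?thesis
    unfolding det_def'[OF mat_carrier] S sum_over_permutations_insert[OF f] permutes_sing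
    by (simp add: sign_swap_id sign_id swap_id_eq)
qed

text \<open>Sarrus' rule, obtained by enumerating permutations through insertion of one point at a
  time.\<close>

lemma det_mat_3:
  fixes f :: "nat \<times> nat \<Rightarrow> 'a::comm_ring_1"
  shows "Determinant.det (Matrix.mat 3 3 f) =
    f (0, 0) * f (1, 1) * f (2, 2) + f (0, 1) * f (1, 2) * f (2, 0) + f (0, 2) * f (1, 0) * f (2, 1)
    - f (0, 0) * f (1, 2) * f (2, 1) - f (0, 1) * f (1, 0) * f (2, 2) - f (0, 2) * f (1, 1) * f (2, 0)"
proof -
  have S: "{0..<3} = {0, 1, 2 :: nat}" by auto
  have f: "finite {1, 2 :: nat}" "0 \<notin> {1, 2 :: nat}" and f': "finite {2 :: nat}" "1 \<notin> {2 :: nat}"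
    by auto
  show ?thesis
    unfolding det_def'[OF mat_carrier] S sum_over_permutations_insert[OF f]
      sum_over_permutations_insert[OF f'] permutes_sing
    by (simp add: sign_swap_id sign_compose permutation_swap_id sign_id swap_id_eq algebra_simps)
qed

text \<open>Index 4 is the largest one in a 3 by 3 Hankel matrix.\<close>

lemma meval_power_sum_poly_upto_4:
  fixes s :: "nat \<Rightarrow> real" and g :: nat
  defines "p \<equiv> \<lambda>n. meval of_int s (power_sum_poly g n)" and "e \<equiv> \<lambda>n. meval of_int s (svar g n)"
  shows "p 0 = real g" "p 1 = e 1" "p 2 = e 1 * p 1 - 2 * e 2"
    "p 3 = e 1 * p 2 - e 2 * p 1 + 3 * e 3" "p 4 = e 1 * p 3 - e 2 * p 2 + e 3 * p 1 - 4 * e 4"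
proof -
  have S: "{1..2} = {1, 2 :: nat}" "{1..3} = {1, 2, 3 :: nat}" by auto
  have Suc: "p (Suc n) = (-1) ^ n * real (Suc n) * e (Suc n)
      + (\<Sum>i\<in>{1..n}. (-1) ^ (i - 1) * e i * p (Suc n - i))" for n
    unfolding p_def e_def by (rule meval_power_sum_poly_Suc)
  show "p 0 = real g"
    by (simp add: p_def power_sum_poly.simps hom_distribs)
  show "p 1 = e 1" "p 2 = e 1 * p 1 - 2 * e 2"
    using Suc[of 0] Suc[of 1] by (simp_all add: numeral_2_eq_2)
  show "p 3 = e 1 * p 2 - e 2 * p 1 + 3 * e 3"
    using Suc[of 2] unfolding S by simp
  show "p 4 = e 1 * p 3 - e 2 * p 2 + e 3 * p 1 - 4 * e 4"
    using Suc[of 3] unfolding S by simp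
qed

text \<open>Here m_2 is the discriminant s_1^2 - 4 s_2.\<close>

lemma Pi_region_2:
  assumes s: "s \<in> Pi_minors 2"
  shows "s \<in> Pi_region 2"
proof -
  let ?p = "\<lambda>n. meval of_int s (power_sum_poly 2 n)"
  have e: "meval of_int s (svar 2 n) = (if n = 1 \<or> n = 2 then s n else 0)" for n
    by (auto simp: svar_def meval_def)
  have p: "?p 0 = 2" "?p 1 = s 1" "?p 2 = s 1 * s 1 - 2 * s 2"
    using meval_power_sum_poly_upto_4[of s 2] by (simp_all add: e)
  have "meval of_int s (minor_poly 2 2) = ?p 0 * ?p 2 - ?p 1 * ?p 1"
    unfolding meval_minor_poly det_mat_2 by (simp add: numeral_2_eq_2)
  also have "\<dots> = (s 1)\<^sup>2 - 4 * s 2"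
    unfolding p by (simp add: power2_eq_square)
  finally have "meval of_int s (minor_poly 2 2) = (s 1)\<^sup>2 - 4 * s 2" .
  then have "0 \<le> (s 1)\<^sup>2 - 4 * s 2"
    using s by (auto simp: Pi_minors_def)
  then obtain x y where "[:s 2, - s 1, 1:] = [:- x, 1:] * [:- y, 1:]"
    by (rule monic_quadratic_splits)
  moreover have "viete_poly 2 s = [:s 2, - s 1, 1:]"
    by (simp add: viete_poly_def s0_def monom_altdef numeral_2_eq_2)
  ultimately show ?thesis
    using s by (intro Pi_regionI_prod_list[where xs = "[x, y]"]) (auto simp: Pi_minors_def)
qed

lemma monic_cubic_has_root:
  fixes b c d :: real
  shows "\<exists>a. poly [:d, c, b, 1:] a = 0"
proof -
  obtain m where m: "\<And>x. m \<le> x \<Longrightarrow> 1 \<le> poly [:d, c, b, 1:] x"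
    using poly_pinfty_gt_lc[of "[:d, c, b, 1:]"] by auto
  \<comment> \<open>This is -p(-X) for the cubic p, so its growth makes p negative far to the
    left.\<close>
  obtain n where n: "\<And>x. n \<le> x \<Longrightarrow> 1 \<le> poly [:- d, c, - b, 1:] x"
    using poly_pinfty_gt_lc[of "[:- d, c, - b, 1:]"] by auto
  define k where "k = max 1 (max m n)"
  have k: "m \<le> k" "n \<le> k" "0 < k" by (auto simp: k_def)
  have "poly [:d, c, b, 1:] (- k) = - poly [:- d, c, - b, 1:] k"
    by (simp add: algebra_simps)
  then have "poly [:d, c, b, 1:] (- k) < 0" "0 < poly [:d, c, b, 1:] k" "- k < k"
    using m[OF k(1)] n[OF k(2)] k(3) by linarith+
  then show ?thesis
    using poly_IVT_pos by blast
qed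

text \<open>If \<open>a\<close> is a real root of the cubic and \<open>X\<^sup>2 - b X + c\<close> is the complementary factor, then
  \<open>m\<^sub>3 = (b\<^sup>2 - 4 c) (a\<^sup>2 - a b + c)\<^sup>2\<close>; when the second factor vanishes, \<open>a\<close> is a root of the quadratic.\<close>

lemma Pi_region_3:
  assumes s: "s \<in> Pi_minors 3"
  shows "s \<in> Pi_region 3"
proof -
  let ?p = "\<lambda>n. meval of_int s (power_sum_poly 3 n)"
  have poly: "viete_poly 3 s = [:- s 3, s 2, - s 1, 1:]"
    by (simp add: viete_poly_def s0_def monom_altdef eval_nat_numeral)
  obtain a where a: "poly [:- s 3, s 2, - s 1, 1:] a = 0"
    using monic_cubic_has_root by blast
  \<comment> \<open>Division of the cubic by X - a gives the quotient X^2 - b X + c; that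
    \<open>a\<close> is a root becomes \<open>s 3 = a * c\<close>.\<close>
  define b where "b = s 1 - a"
  define c where "c = s 2 - a * b"
  have s1: "s 1 = a + b" and s2: "s 2 = a * b + c"
    by (simp_all add: b_def c_def)
  have s3: "s 3 = a * c"
    using a unfolding s1 s2 by (simp add: algebra_simps)
  have e: "meval of_int s (svar 3 1) = a + b" "meval of_int s (svar 3 2) = a * b + c"
    "meval of_int s (svar 3 3) = a * c" "meval of_int s (svar 3 4) = 0"
    using s1 s2 s3 by (simp_all add: svar_def meval_def)
  note newton = meval_power_sum_poly_upto_4[of s 3, unfolded e]
  have p0: "?p 0 = 3" and p1: "?p 1 = a + b"
    using newton(1,2) by simp_all
  have p2: "?p 2 = a\<^sup>2 + b\<^sup>2 - 2 * c"
    unfolding newton(3) p1 by (simp add: power2_eq_square algebra_simps)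
  have p3: "?p 3 = a ^ 3 + b ^ 3 - 3 * b * c"
    unfolding newton(4) p1 p2 by (simp add: power2_eq_square power3_eq_cube power4_eq_xxxx algebra_simps)
  have p4: "?p 4 = a ^ 4 + b ^ 4 - 4 * b\<^sup>2 * c + 2 * c\<^sup>2"
    unfolding newton(5) p1 p2 p3 by (simp add: power2_eq_square power3_eq_cube power4_eq_xxxx algebra_simps)
  have "meval of_int s (minor_poly 3 3) = ?p 0 * ?p 2 * ?p 4 + ?p 1 * ?p 3 * ?p 2 + ?p 2 * ?p 1 * ?p 3
      - ?p 0 * ?p 3 * ?p 3 - ?p 1 * ?p 1 * ?p 4 - ?p 2 * ?p 2 * ?p 2"
    unfolding meval_minor_poly det_mat_3 by (simp add: eval_nat_numeral)
  also have "\<dots> = (b\<^sup>2 - 4 * c) * (a\<^sup>2 - a * b + c)\<^sup>2"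
    unfolding p0 p1 p2 p3 p4 by (simp add: power2_eq_square power3_eq_cube power4_eq_xxxx algebra_simps)
  finally have "meval of_int s (minor_poly 3 3) = (b\<^sup>2 - 4 * c) * (a\<^sup>2 - a * b + c)\<^sup>2" .
  moreover have "0 \<le> meval of_int s (minor_poly 3 3)"
    using s unfolding Pi_minors_def by fastforce
  ultimately have nonneg: "0 \<le> (b\<^sup>2 - 4 * c) * (a\<^sup>2 - a * b + c)\<^sup>2"
    by simp
  have "0 \<le> b\<^sup>2 - 4 * c"
  proof (cases "a\<^sup>2 - a * b + c = 0")
    case True
    then have "b\<^sup>2 - 4 * c = (b - 2 * a)\<^sup>2"
      by (simp add: power2_eq_square algebra_simps)
    then show ?thesis by simp
  next
    case False
    then show ?thesis using nonneg by (simp add: zero_le_mult_iff)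
  qed
  then obtain x y where xy: "[:c, - b, 1:] = [:- x, 1:] * [:- y, 1:]"
    by (rule monic_quadratic_splits)
  have "viete_poly 3 s = [:- a, 1:] * [:c, - b, 1:]"
    unfolding poly s1 s2 s3 by simp
  then show ?thesis
    unfolding xy using s
    by (intro Pi_regionI_prod_list[where xs = "[a, x, y]"]) (auto simp: Pi_minors_def)
qed

text \<open>The upper bound on g is sharp: \<open>Pi_minors_too_large\<close> gives a counterexample
  for g = 4.\<close>

lemma Pi_minors_subset_Pi_region:
  assumes "1 \<le> g" "g \<le> 3"
  shows "Pi_minors g \<subseteq> Pi_region g"
proof -
  consider "g = 1" | "g = 2" | "g = 3" using assms by linarith
  then show ?thesis
    using Pi_region_1 Pi_region_2 Pi_region_3 by cases (auto simp: Pi_minors_def)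
qed

theorem theorem7p4:
  fixes g :: nat
  assumes "1 \<le> g"
  shows "Sigma_region g = Theta_region g \<inter> Pi_region g
    \<and> Pi_region g \<subseteq> Pi_minors g
    \<and> (g \<le> 3 \<longrightarrow> Pi_region g = Pi_minors g)
    \<and> Sigma_region g = viete g ` alcove_closure g
    \<and> Sigma_region g \<in> semialgebraic_sets g
    \<and> subtopology (powertop_real {1..g}) (Sigma_region g) homeomorphic_space
        subtopology (powertop_real UNIV) (standard_simplex g)
    \<and> Sigma_region g \<subseteq> (\<Pi>\<^sub>E i\<in>{1..g}. {- (2 ^ i * real (g choose i))..2 ^ i * real (g choose i)})"
  using Sigma_region_eq Pi_region_subset_Pi_minors Pi_minors_subset_Pi_region[OF assms] Sigma_region_eq_alcove
    semialgebraic_Sigma_region Sigma_region_subset_box Sigma_region_homeomorphic_simplex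
  by (intro conjI impI equalityI) blast+

end
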